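(* There exists a constant $C$ such that, provided $p\ge C/n$, and for sufficiently small constant $\epsilon>0$, $\mathrm{instopt}(G_{n,p},\epsilon,1/10)=\Omega(1/p)$ samples in the sampling model.
   Context: $G_{n,p}$ denotes the Erdős–Rényi random graph on $n$ vertices (each pair is an edge independently with probability $p$); the claim concerns a graph drawn from it. Sampling model: a (nonadaptive) sampling algorithm chooses, independently of the input, a distribution over sets $S$ of vertex pairs, receives $E(G')\cap S$ for its input $G'$, and pays $\mathbb{E}|E(G')\cap S|$ samples. An algorithm solves $G$ with $S$ samples and $(\epsilon,\delta)$ error if, for every graph $G'$ isomorphic to some subgraph of $G$, it returns a value in $T(G')\pm\epsilon T(G)$ with probability at least $1-\delta$ using at most $S$ samples, where $T(H)$ is the number of triangles of $H$; $\mathrm{instopt}(G,\epsilon,\delta)$ is the least such $S$. *)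

theory Defs
  imports "HOL-Probability.Probability" "HOL-Probability.Product_PMF"
begin

text \<open>
  A graph on the vertex set \<open>{..<n}\<close> is given by its set of edges, a subset of \<open>vpairs n\<close>.
\<close>

type_synonym edges = "nat set set"

definition vpairs :: "nat \<Rightarrow> edges" where
  "vpairs n = {e. e \<subseteq> {..<n} \<and> card e = 2}"

definition triangles :: "edges \<Rightarrow> nat set set" where
  "triangles E = {t. card t = 3 \<and> (\<forall>u\<in>t. \<forall>v\<in>t. u \<noteq> v \<longrightarrow> {u, v} \<in> E)}"

definition num_triangles :: "edges \<Rightarrow> nat" where
  "num_triangles E = card (triangles E)"

definition graph_iso :: "nat \<Rightarrow> edges \<Rightarrow> edges \<Rightarrow> bool" where
  "graph_iso n E E' \<longleftrightarrow> (\<exists>\<pi>. bij_betw \<pi> {..<n} {..<n} \<and> E' = (\<lambda>e. \<pi> ` e) ` E)"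

definition gnp :: "nat \<Rightarrow> real \<Rightarrow> edges pmf" where
  "gnp n p = map_pmf (\<lambda>f. {e \<in> vpairs n. f e})
     (Pi_pmf (vpairs n) False (\<lambda>_. bernoulli_pmf p))"

text \<open>
  A nonadaptive sampling algorithm consists of a distribution \<open>D\<close> of the queried set \<open>S\<close> of
  vertex pairs and a randomized output rule \<open>A\<close>, which sees \<open>S\<close> and \<open>E \<inter> S\<close> only.
\<close>

definition run_alg :: "edges pmf \<Rightarrow> (edges \<Rightarrow> edges \<Rightarrow> real pmf) \<Rightarrow> edges \<Rightarrow> real pmf" where
  "run_alg D A E = bind_pmf D (\<lambda>S. A S (E \<inter> S))"

definition sample_cost :: "edges pmf \<Rightarrow> edges \<Rightarrow> real" where
  "sample_cost D E = measure_pmf.expectation D (\<lambda>S. real (card (E \<inter> S)))"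

definition solves ::
  "nat \<Rightarrow> edges \<Rightarrow> real \<Rightarrow> real \<Rightarrow> real \<Rightarrow> edges pmf \<Rightarrow> (edges \<Rightarrow> edges \<Rightarrow> real pmf) \<Rightarrow> bool"
where
  "solves n G \<epsilon> \<delta> s D A \<longleftrightarrow>
     set_pmf D \<subseteq> Pow (vpairs n) \<and>
     (\<forall>G'. (\<exists>H\<subseteq>G. graph_iso n H G') \<longrightarrow>
        measure_pmf.prob (run_alg D A G')
          {real (num_triangles G') - \<epsilon> * real (num_triangles G) ..
           real (num_triangles G') + \<epsilon> * real (num_triangles G)} \<ge> 1 - \<delta> \<and>
        sample_cost D G' \<le> s)"

definition instopt :: "nat \<Rightarrow> edges \<Rightarrow> real \<Rightarrow> real \<Rightarrow> real" where
  "instopt n G \<epsilon> \<delta> = Inf {s. \<exists>D A. solves n G \<epsilon> \<delta> s D A}"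

text \<open>
  The infimum is over a nonempty set that is bounded below, so it is not a junk value.
\<close>

lemma solves_nonneg:
  assumes "solves n G \<epsilon> \<delta> s D A"
  shows "0 \<le> s"
proof -
  have "graph_iso n {} {}"
    unfolding graph_iso_def by (auto intro: exI[of _ id])
  then have "sample_cost D {} \<le> s"
    using assms unfolding solves_def by blast
  then show ?thesis
    by (simp add: sample_cost_def)
qed

lemma instopt_bdd_below: "bdd_below {s. \<exists>D A. solves n G \<epsilon> \<delta> s D A}"
  by (rule bdd_belowI[of _ 0]) (auto dest: solves_nonneg)

lemma finite_vpairs: "finite (vpairs n)"
  by (rule finite_subset[of _ "Pow {..<n}"]) (auto simp: vpairs_def)

lemma graph_iso_vpairs:
  assumes "H \<subseteq> vpairs n" "graph_iso n H G'"
  shows "G' \<subseteq> vpairs n"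
proof -
  obtain \<pi> where p: "bij_betw \<pi> {..<n} {..<n}" and G': "G' = (\<lambda>e. \<pi> ` e) ` H"
    using assms(2) unfolding graph_iso_def by blast
  show ?thesis
  proof
    fix e' assume "e' \<in> G'"
    then obtain e where e: "e \<in> H" "e' = \<pi> ` e" using G' by blast
    have e2: "e \<subseteq> {..<n}" "card e = 2" using e assms(1) by (auto simp: vpairs_def)
    have "inj_on \<pi> e" using p e2(1) by (meson bij_betw_def inj_on_subset)
    then have "card e' = 2" using e e2 by (simp add: card_image)
    moreover have "e' \<subseteq> {..<n}" using p e e2(1) by (auto simp: bij_betw_def)
    ultimately show "e' \<in> vpairs n" by (simp add: vpairs_def)
  qed
qed

lemma instopt_nonempty:
  assumes "G \<subseteq> vpairs n" "0 \<le> \<epsilon>" "0 \<le> \<delta>"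
  shows "{s. \<exists>D A. solves n G \<epsilon> \<delta> s D A} \<noteq> {}"
proof -
  have "solves n G \<epsilon> \<delta> (real (card (vpairs n))) (return_pmf (vpairs n))
          (\<lambda>S E. return_pmf (real (num_triangles E)))"
    unfolding solves_def
  proof (intro conjI allI impI)
    fix G' assume "\<exists>H\<subseteq>G. graph_iso n H G'"
    then have "G' \<subseteq> vpairs n" using assms(1) graph_iso_vpairs by blast
    then have eq: "G' \<inter> vpairs n = G'" by blast
    show "sample_cost (return_pmf (vpairs n)) G' \<le> real (card (vpairs n))"
      by (simp add: sample_cost_def card_mono finite_vpairs)
    show "1 - \<delta> \<le> measure_pmf.prob (run_alg (return_pmf (vpairs n))
            (\<lambda>S E. return_pmf (real (num_triangles E))) G')
          {real (num_triangles G') - \<epsilon> * real (num_triangles G) ..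
           real (num_triangles G') + \<epsilon> * real (num_triangles G)}"
      using assms by (simp add: run_alg_def bind_return_pmf eq)
  qed simp
  then show ?thesis by blast
qed

end

theory Submission
  imports Defs "HOL-Combinatorics.Permutations"
begin

text \<open>
  Relabel \<open>G\<close> by a uniformly random permutation and take a uniformly random vertex set \<open>W\<close>.
  The edges of \<open>G\<close> crossing \<open>W\<close> span no triangle, whereas the non-crossing edges keep a quarter of
  the triangles on average. If the queried part \<open>G \<inter> S\<close> is acyclic, hence bipartite with some side
  \<open>W0\<close>, then replacing \<open>W\<close> by its symmetric difference with \<open>W0\<close> exchanges the two views, so the
  algorithm cannot tell the two inputs apart. A correct algorithm therefore sees a cycle with
  constant probability. But a cost of at most \<open>s\<close> forces \<open>S\<close> to have \<open>O(s/p)\<close> pairs on average;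
  such a set has at most \<open>(2|S|)^(k/2)\<close> closed walks of length \<open>k\<close>, each of which lands in the random
  graph with probability \<open>p^k\<close>. If \<open>|S| \<le> a\<^sup>2/(2p\<^sup>2)\<close>, the expected number of cycles is at most
  the sum of \<open>a^k\<close> over \<open>k \<ge> 3\<close>, which is small, so \<open>s\<close> has to be of order \<open>1/p\<close>.
\<close>

section \<open>Cycles and bipartitions\<close>

text \<open>A walk is given by its two ends and the list of its inner vertices: \<open>m\<close>
  inner vertices make \<open>m + 1\<close> steps, and a closed walk has equal ends.\<close>

fun walk_edges :: "'a \<Rightarrow> 'a list \<Rightarrow> 'a \<Rightarrow> 'a set set" where
  "walk_edges u [] v = {{u, v}}"
| "walk_edges u (x # xs) v = insert {u, x} (walk_edges x xs v)"

lemma walk_edges_append: "walk_edges u (xs @ x # ys) v = walk_edges u xs x \<union> walk_edges x ys v"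
  by (induction xs arbitrary: u) auto

lemma Union_walk_edges: "\<Union> (walk_edges u xs v) = insert u (insert v (set xs))"
  by (induction xs arbitrary: u) auto

lemma finite_walk_edges: "finite (walk_edges u xs v)"
  by (induction xs arbitrary: u) auto

lemma walk_edges_map: "walk_edges (f u) (map f xs) (f v) = (`) f ` walk_edges u xs v"
  by (induction xs arbitrary: u) auto

lemma card_walk_edges_path:
  "distinct (u # xs @ [v]) \<Longrightarrow> card (walk_edges u xs v) = Suc (length xs)"
proof (induction xs arbitrary: u)
  case (Cons x xs)
  have "{u, x} \<notin> walk_edges x xs v"
    using Union_walk_edges[of x xs v] Cons.prems by auto
  then show ?case using Cons by (simp add: finite_walk_edges)
qed auto

lemma card_edge_of_path:
  "distinct (u # xs @ [v]) \<Longrightarrow> e \<in> walk_edges u xs v \<Longrightarrow> card e = 2"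
  by (induction xs arbitrary: u) auto

lemma card_edge_of_cycle:
  assumes "distinct (u # xs)" "xs \<noteq> []" "e \<in> walk_edges u xs u"
  shows "card e = 2"
proof -
  obtain x ys where "xs = x # ys" using assms(2) by (cases xs) auto
  then show ?thesis using assms(1,3) card_edge_of_path[of x ys u e] by auto
qed

text \<open>Without its first edge the cycle is a path back to \<open>u\<close>. Two inner vertices
  are required because the walk \<open>u\<close>, \<open>x\<close>, \<open>u\<close> uses one edge
  twice.\<close>

lemma card_walk_edges_cycle:
  assumes "distinct (u # xs)" "2 \<le> length xs"
  shows "card (walk_edges u xs u) = Suc (length xs)"
proof -
  obtain x y ys where xs: "xs = x # y # ys"
    using assms(2) by (cases xs; cases "tl xs") auto
  have "{u, x} \<notin> walk_edges x (y # ys) u"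
    using Union_walk_edges[of y ys u] assms(1) by (auto simp: xs doubleton_eq_iff)
  moreover have "card (walk_edges x (y # ys) u) = Suc (length (y # ys))"
    using assms(1) by (intro card_walk_edges_path) (auto simp: xs)
  ultimately show ?thesis by (simp add: xs finite_walk_edges)
qed

text \<open>A path is extended step by step; when the next vertex already lies on it, the path is
  cut off there.\<close>

lemma rtrancl_distinct_walk:
  assumes "(u, v) \<in> {(a, b). {a, b} \<in> F}\<^sup>*" "u \<noteq> v"
  shows "\<exists>xs. distinct (u # xs @ [v]) \<and> walk_edges u xs v \<subseteq> F"
  using assms
proof (induction rule: rtrancl_induct)
  case (step y z)
  show ?case
  proof (cases "y = u")
    case True
    then show ?thesis using step by (intro exI[of _ "[]"]) auto
  next
    case False
    then obtain xs where xs: "distinct (u # xs @ [y])" "walk_edges u xs y \<subseteq> F"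
      using step by blast
    consider "z = y" | "z \<in> set xs" | "z \<noteq> y" "z \<notin> set xs" by blast
    then show ?thesis
    proof cases
      case 2
      then obtain ys zs where "xs = ys @ z # zs" by (auto simp: in_set_conv_decomp)
      with xs show ?thesis by (intro exI[of _ ys]) (auto simp: walk_edges_append)
    next
      case 3
      then show ?thesis using xs step
        by (intro exI[of _ "xs @ [y]"]) (auto simp: walk_edges_append)
    qed (use xs in auto)
  qed
qed simp

text \<open>The length condition asks for at least three vertices in all, which excludes going back
  and forth along one edge.\<close>

definition has_cycle :: "'a set set \<Rightarrow> bool" where
  "has_cycle F \<longleftrightarrow> (\<exists>u xs. distinct (u # xs) \<and> 2 \<le> length xs \<and> walk_edges u xs u \<subseteq> F)"

text \<open>For two-element edges this is the cut between \<open>W\<close> and its complement, so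
  \<open>cut_edges W F = F\<close> says that \<open>F\<close> is bipartite with side
  \<open>W\<close>.\<close>

definition cut_edges :: "'a set \<Rightarrow> 'a set set \<Rightarrow> 'a set set" where
  "cut_edges W E = {e \<in> E. card (e \<inter> W) = 1}"

lemma cut_edges_subset: "cut_edges W E \<subseteq> E"
  by (auto simp: cut_edges_def)

lemma card_doubleton_Int_eq_1:
  "a \<noteq> b \<Longrightarrow> card ({a, b} \<inter> W) = 1 \<longleftrightarrow> (a \<in> W) \<noteq> (b \<in> W)"
  by (cases "a \<in> W"; cases "b \<in> W") (auto simp: Int_insert_left)

text \<open>Edges are inserted one by one. If both ends of the new edge \<open>{u, v}\<close> lie on
  the same side, the component \<open>U\<close> of \<open>u\<close> is switched to the other side. A
  path from \<open>u\<close> to \<open>v\<close> would close a cycle with the new edge, so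
  \<open>v\<close> keeps its side.\<close>

lemma acyclic_imp_bipartite:
  assumes "finite F" "\<And>e. e \<in> F \<Longrightarrow> card e = 2" "\<not> has_cycle F"
  shows "\<exists>W. W \<subseteq> \<Union> F \<and> cut_edges W F = F"
  using assms
proof (induction F)
  case (insert e F)
  have "\<not> has_cycle F" using insert.prems by (auto simp: has_cycle_def)
  then obtain W where W: "W \<subseteq> \<Union> F" "cut_edges W F = F"
    using insert by auto
  obtain u v where e: "e = {u, v}" "u \<noteq> v"
    using insert.prems(1)[of e] by (auto simp: card_2_iff)
  show ?case
  proof (cases "card (e \<inter> W) = 1")
    case True
    then show ?thesis using W by (intro exI[of _ W]) (auto simp: cut_edges_def)
  next
    case False
    define R where "R = {(a, b). {a, b} \<in> F}"
    define U where "U = {w. (u, w) \<in> R\<^sup>*}"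
    have "v \<notin> U"
    proof
      assume "v \<in> U"
      then obtain xs where xs: "distinct (u # xs @ [v])" "walk_edges u xs v \<subseteq> F"
        using rtrancl_distinct_walk[of u v F] e(2) by (auto simp: U_def R_def)
      \<comment> \<open>A path without inner vertices would be the edge \<open>e\<close>, which is
        not in \<open>F\<close>; hence \<open>xs @ [v]\<close> has the two entries required of a
        cycle.\<close>
      have "xs \<noteq> []" using xs(2) insert.hyps(2) e by auto
      moreover have "walk_edges u (xs @ [v]) u \<subseteq> insert e F"
        using xs(2) e by (auto simp: walk_edges_append insert_commute)
      ultimately have "has_cycle (insert e F)"
        unfolding has_cycle_def using xs(1)
        by (intro exI[of _ u] exI[of _ "xs @ [v]"]) (cases xs, auto)
      then show False using insert.prems by blast
    qed
    define W' where "W' = (W - U) \<union> (U - W)"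
    have U_sub: "w = u \<or> w \<in> \<Union> F" if "w \<in> U" for w
    proof -
      have "(u, w) \<in> R\<^sup>*" using that by (simp add: U_def)
      then show ?thesis by (cases rule: rtranclE) (auto simp: R_def)
    qed
    have "card (f \<inter> W') = 1" if f: "f \<in> F" for f
    proof -
      obtain a b where ab: "f = {a, b}" "a \<noteq> b"
        using insert.prems(1)[of f] f by (auto simp: card_2_iff)
      \<comment> \<open>No edge of \<open>F\<close> leaves \<open>U\<close>, so switching
        \<open>U\<close> moves both ends of \<open>f\<close> or neither.\<close>
      have "a \<in> U \<longleftrightarrow> b \<in> U"
        using f ab by (auto simp: U_def R_def insert_commute intro: rtrancl_into_rtrancl)
      moreover have "(a \<in> W) \<noteq> (b \<in> W)"
        using W(2) f card_doubleton_Int_eq_1[OF ab(2)] ab(1) by (auto simp: cut_edges_def)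
      ultimately show ?thesis
        unfolding ab(1) card_doubleton_Int_eq_1[OF ab(2)] by (auto simp: W'_def)
    qed
    moreover have "card (e \<inter> W') = 1"
      using False \<open>v \<notin> U\<close> unfolding e(1) card_doubleton_Int_eq_1[OF e(2)]
      by (auto simp: W'_def U_def)
    moreover have "W' \<subseteq> \<Union> (insert e F)"
      using W(1) U_sub e by (auto simp: W'_def)
    ultimately show ?thesis by (intro exI[of _ W']) (auto simp: cut_edges_def)
  qed
qed (auto simp: cut_edges_def)

text \<open>Every edge of \<open>F\<close> has exactly one end in \<open>W0\<close>, so passing to
  the symmetric difference toggles the side of exactly one of its ends.\<close>

lemma cut_edges_flip:
  assumes "\<And>e. e \<in> F \<Longrightarrow> card e = 2" "cut_edges W0 F = F"
  shows "cut_edges ((W - W0) \<union> (W0 - W)) F = F - cut_edges W F"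
proof -
  have "card (e \<inter> ((W - W0) \<union> (W0 - W))) = 1 \<longleftrightarrow> card (e \<inter> W) \<noteq> 1" if "e \<in> F" for e
  proof -
    obtain a b where ab: "e = {a, b}" "a \<noteq> b"
      using assms(1)[OF \<open>e \<in> F\<close>] by (auto simp: card_2_iff)
    have "(a \<in> W0) \<noteq> (b \<in> W0)"
      using assms(2) that card_doubleton_Int_eq_1[OF ab(2)] ab(1) by (auto simp: cut_edges_def)
    then show ?thesis unfolding ab(1) card_doubleton_Int_eq_1[OF ab(2)] by auto
  qed
  then show ?thesis by (auto simp: cut_edges_def)
qed

text \<open>Symmetric difference with a side \<open>W0\<close> of the bipartition is an involution
  on the subsets of \<open>V\<close> that exchanges the two arguments of \<open>h\<close>. Later
  \<open>h\<close> is the probability that the algorithm, shown this set of edges, answers close to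
  0.\<close>

lemma sum_cut_edges_eq_sum_uncut:
  fixes h :: "'a set set \<Rightarrow> 'b::comm_monoid_add"
  assumes "\<And>e. e \<in> F \<Longrightarrow> e \<subseteq> V \<and> card e = 2" "finite F" "\<not> has_cycle F"
  shows "(\<Sum>W\<in>Pow V. h (cut_edges W F)) = (\<Sum>W\<in>Pow V. h (F - cut_edges W F))"
proof -
  obtain W0 where W0: "W0 \<subseteq> \<Union> F" "cut_edges W0 F = F"
    using acyclic_imp_bipartite[of F] assms by blast
  have "W0 \<subseteq> V" using W0 assms(1) by blast
  let ?f = "\<lambda>W. (W - W0) \<union> (W0 - W)"
  have flip: "F - cut_edges (?f W) F = cut_edges W F" for W
    using cut_edges_flip[OF _ W0(2)] assms(1) cut_edges_subset[of W F] by auto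
  show ?thesis
  proof (rule sum.reindex_bij_witness[of _ ?f ?f])
    fix W
    show "h (F - cut_edges (?f W) F) = h (cut_edges W F)" by (simp only: flip)
  qed (use \<open>W0 \<subseteq> V\<close> in auto)
qed

section \<open>Counting closed walks\<close>

text \<open>The number of walks of length \<open>m + 1\<close> is a power of the adjacency matrix, and the
  Frobenius norm is submultiplicative.\<close>

lemma sum_product_square_le:
  fixes A B :: "'a \<Rightarrow> 'a \<Rightarrow> real"
  shows "(\<Sum>u\<in>V. \<Sum>v\<in>V. (\<Sum>w\<in>V. A u w * B w v)\<^sup>2)
     \<le> (\<Sum>u\<in>V. \<Sum>w\<in>V. (A u w)\<^sup>2) * (\<Sum>w\<in>V. \<Sum>v\<in>V. (B w v)\<^sup>2)"
proof -
  have "(\<Sum>u\<in>V. \<Sum>v\<in>V. (\<Sum>w\<in>V. A u w * B w v)\<^sup>2)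
     \<le> (\<Sum>u\<in>V. \<Sum>v\<in>V. (\<Sum>w\<in>V. (A u w)\<^sup>2) * (\<Sum>w\<in>V. (B w v)\<^sup>2))"
    by (intro sum_mono Cauchy_Schwarz_ineq_sum)
  also have "\<dots> = (\<Sum>u\<in>V. \<Sum>w\<in>V. (A u w)\<^sup>2) * (\<Sum>v\<in>V. \<Sum>w\<in>V. (B w v)\<^sup>2)"
    by (simp add: sum_product)
  also have "(\<Sum>v\<in>V. \<Sum>w\<in>V. (B w v)\<^sup>2) = (\<Sum>w\<in>V. \<Sum>v\<in>V. (B w v)\<^sup>2)"
    by (rule sum.swap)
  finally show ?thesis .
qed

definition walks :: "'a set set \<Rightarrow> nat \<Rightarrow> 'a \<Rightarrow> 'a \<Rightarrow> 'a list set" where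
  "walks S m u v = {xs. length xs = m \<and> walk_edges u xs v \<subseteq> S}"

lemma walks_0: "walks S 0 u v = (if {u, v} \<in> S then {[]} else {})"
  by (auto simp: walks_def)

lemma finite_walks:
  assumes "finite V" "\<Union> S \<subseteq> V"
  shows "finite (walks S m u v)"
proof (rule finite_subset)
  show "walks S m u v \<subseteq> {xs. set xs \<subseteq> V \<and> length xs = m}"
  proof
    fix xs assume "xs \<in> walks S m u v"
    then have "\<Union> (walk_edges u xs v) \<subseteq> V" "length xs = m"
      using assms(2) by (auto simp: walks_def)
    then show "xs \<in> {xs. set xs \<subseteq> V \<and> length xs = m}"
      unfolding Union_walk_edges by auto
  qed
qed (rule finite_lists_length_eq[OF assms(1)])

text \<open>Splitting off the first inner vertex amounts to one multiplication by the adjacency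
  matrix.\<close>

lemma card_walks_Suc_le:
  assumes "finite V" "\<Union> S \<subseteq> V"
  shows "real (card (walks S (Suc m) u v))
    \<le> (\<Sum>w\<in>V. of_bool ({u, w} \<in> S) * real (card (walks S m w v)))"
proof -
  have "walks S (Suc m) u v \<subseteq> (\<Union>w\<in>{w\<in>V. {u, w} \<in> S}. (#) w ` walks S m w v)"
  proof
    fix xs assume "xs \<in> walks S (Suc m) u v"
    then obtain w ys where "xs = w # ys" "{u, w} \<in> S" "ys \<in> walks S m w v"
      by (auto simp: walks_def length_Suc_conv)
    then show "xs \<in> (\<Union>w\<in>{w\<in>V. {u, w} \<in> S}. (#) w ` walks S m w v)"
      using assms(2) by auto
  qed
  then have "card (walks S (Suc m) u v) \<le> card (\<Union>w\<in>{w\<in>V. {u, w} \<in> S}. (#) w ` walks S m w v)"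
    by (rule card_mono[rotated]) (use assms finite_walks[OF assms] in auto)
  also have "\<dots> \<le> (\<Sum>w\<in>{w\<in>V. {u, w} \<in> S}. card ((#) w ` walks S m w v))"
    by (rule card_UN_le) (use assms in auto)
  also have "\<dots> = (\<Sum>w\<in>{w\<in>V. {u, w} \<in> S}. card (walks S m w v))"
    by (simp add: card_image)
  also have "\<dots> = (\<Sum>w\<in>V. of_bool ({u, w} \<in> S) * card (walks S m w v))"
    using assms(1) by (simp add: sum.inter_filter of_bool_def if_distrib[of "\<lambda>x. x * _"] cong: if_cong)
  finally have "real (card (walks S (Suc m) u v)) \<le>
      real (\<Sum>w\<in>V. of_bool ({u, w} \<in> S) * card (walks S m w v))"
    by linarith
  then show ?thesis by simp
qed

text \<open>The left side is the squared Frobenius norm of the adjacency matrix; each edge accounts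
  for at most two ordered pairs.\<close>

lemma sum_adjacency_le:
  assumes "finite V" "finite S" "\<And>e. e \<in> S \<Longrightarrow> card e = 2"
  shows "(\<Sum>u\<in>V. \<Sum>v\<in>V. (of_bool ({u, v} \<in> S) :: real)\<^sup>2) \<le> 2 * card S"
proof -
  have "(\<Sum>u\<in>V. \<Sum>v\<in>V. (of_bool ({u, v} \<in> S) :: real)\<^sup>2)
      = (\<Sum>z\<in>V\<times>V. of_bool (z \<in> {(u, v). {u, v} \<in> S}))"
    by (simp add: sum.cartesian_product power2_eq_square case_prod_beta flip: of_bool_conj)
  also have "\<dots> = card ((V \<times> V) \<inter> {(u, v). {u, v} \<in> S})"
    using assms(1) by (simp add: of_bool_def sum.If_cases del: mem_Collect_eq)
  also have "card ((V \<times> V) \<inter> {(u, v). {u, v} \<in> S}) \<le> card (\<Union>e\<in>S. {(u, v). {u, v} = e})"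
  proof (rule card_mono)
    have "finite {(u, v). {u, v} = e}" if "e \<in> S" for e
    proof (rule finite_subset)
      show "{(u, v). {u, v} = e} \<subseteq> e \<times> e" by auto
      show "finite (e \<times> e)" using assms(3)[OF that] by (simp add: card_ge_0_finite)
    qed
    then show "finite (\<Union>e\<in>S. {(u, v). {u, v} = e})"
      using assms(2) by blast
  qed auto
  also have "\<dots> \<le> (\<Sum>e\<in>S. card {(u, v). {u, v} = e})"
    by (rule card_UN_le[OF assms(2)])
  also have "\<dots> \<le> (\<Sum>e\<in>S. 2)"
  proof (rule sum_mono)
    fix e assume "e \<in> S"
    then obtain a b where "e = {a, b}" "a \<noteq> b"
      using assms(3)[of e] by (auto simp: card_2_iff)
    then have "{u, v} = e \<longleftrightarrow> (u, v) = (a, b) \<or> (u, v) = (b, a)" for u v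
      by (simp add: doubleton_eq_iff)
    then have "{(u, v). {u, v} = e} \<subseteq> {(a, b), (b, a)}" by blast
    then have "card {(u, v). {u, v} = e} \<le> card {(a, b), (b, a)}"
      by (intro card_mono) simp_all
    then show "card {(u, v). {u, v} = e} \<le> 2"
      by (rule order_trans) (simp add: card_insert_le_m1)
  qed
  finally show ?thesis by simp
qed

text \<open>Each further step multiplies by the adjacency matrix, whose squared Frobenius norm is at
  most \<open>2 * card S\<close>.\<close>

lemma sum_walks_square_le:
  assumes "finite V" "\<Union> S \<subseteq> V" "finite S" "\<And>e. e \<in> S \<Longrightarrow> card e = 2"
  shows "(\<Sum>u\<in>V. \<Sum>v\<in>V. (real (card (walks S m u v)))\<^sup>2) \<le> (2 * card S) ^ Suc m"
proof (induction m)
  case 0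
  have "real (card (walks S 0 u v)) = of_bool ({u, v} \<in> S)" for u v
    by (simp add: walks_0)
  then show ?case using sum_adjacency_le[OF assms(1,3) assms(4)] by simp
next
  case (Suc m)
  have "(\<Sum>u\<in>V. \<Sum>v\<in>V. (real (card (walks S (Suc m) u v)))\<^sup>2)
     \<le> (\<Sum>u\<in>V. \<Sum>v\<in>V. (\<Sum>w\<in>V. of_bool ({u, w} \<in> S) * real (card (walks S m w v)))\<^sup>2)"
    by (intro sum_mono power_mono card_walks_Suc_le assms) auto
  also have "\<dots> \<le> (\<Sum>u\<in>V. \<Sum>w\<in>V. (of_bool ({u, w} \<in> S))\<^sup>2) *
      (\<Sum>w\<in>V. \<Sum>v\<in>V. (real (card (walks S m w v)))\<^sup>2)"
    by (rule sum_product_square_le)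
  also have "\<dots> \<le> real (2 * card S) * real ((2 * card S) ^ Suc m)"
    using sum_adjacency_le[OF assms(1,3) assms(4)] Suc by (intro mult_mono) (auto intro!: sum_nonneg)
  finally show ?case by simp
qed

text \<open>The sum is at most the trace of the adjacency matrix times the matrix that counts walks
  with \<open>m\<close> inner vertices, and Cauchy-Schwarz bounds this trace by the product of the
  two Frobenius norms. A closed walk with \<open>Suc m\<close> inner vertices has
  \<open>m + 2\<close> steps, whence the exponent.\<close>

lemma sum_closed_walks_le:
  assumes "finite V" "\<Union> S \<subseteq> V" "finite S" "\<And>e. e \<in> S \<Longrightarrow> card e = 2"
  shows "(\<Sum>u\<in>V. real (card (walks S (Suc m) u u))) \<le> sqrt (2 * card S) ^ (m + 2)"
proof -
  let ?A = "\<lambda>z. of_bool ({fst z, snd z} \<in> S) :: real"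
  let ?B = "\<lambda>z. real (card (walks S m (snd z) (fst z)))"
  have "(\<Sum>u\<in>V. real (card (walks S (Suc m) u u)))
      \<le> (\<Sum>u\<in>V. \<Sum>w\<in>V. of_bool ({u, w} \<in> S) * real (card (walks S m w u)))"
    by (intro sum_mono card_walks_Suc_le assms)
  also have "\<dots> = (\<Sum>z\<in>V\<times>V. ?A z * ?B z)"
    by (simp add: sum.cartesian_product case_prod_beta)
  also have "\<dots> \<le> sqrt ((2 * card S) ^ (m + 2))"
  proof (rule real_le_rsqrt)
    have "(\<Sum>z\<in>V\<times>V. ?A z * ?B z)\<^sup>2 \<le> (\<Sum>z\<in>V\<times>V. (?A z)\<^sup>2) * (\<Sum>z\<in>V\<times>V. (?B z)\<^sup>2)"
      by (rule Cauchy_Schwarz_ineq_sum)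
    also have "(\<Sum>z\<in>V\<times>V. (?A z)\<^sup>2) = (\<Sum>u\<in>V. \<Sum>v\<in>V. (of_bool ({u, v} \<in> S))\<^sup>2)"
      by (simp add: sum.cartesian_product case_prod_beta)
    also have "(\<Sum>z\<in>V\<times>V. (?B z)\<^sup>2) = (\<Sum>u\<in>V. \<Sum>v\<in>V. (real (card (walks S m v u)))\<^sup>2)"
      by (simp add: sum.cartesian_product case_prod_beta)
    also have "\<dots> = (\<Sum>u\<in>V. \<Sum>v\<in>V. (real (card (walks S m u v)))\<^sup>2)"
      by (rule sum.swap)
    also have "(\<Sum>u\<in>V. \<Sum>v\<in>V. (of_bool ({u, v} \<in> S) :: real)\<^sup>2) * \<dots> \<le> real (2 * card S) * real ((2 * card S) ^ Suc m)"
      using sum_adjacency_le[OF assms(1,3) assms(4)] sum_walks_square_le[OF assms, of m]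
      by (intro mult_mono) (auto intro!: sum_nonneg)
    finally show "(\<Sum>z\<in>V\<times>V. ?A z * ?B z)\<^sup>2 \<le> real ((2 * card S) ^ (m + 2))" by simp
  qed
  also have "\<dots> = sqrt (2 * card S) ^ (m + 2)"
    by (simp only: real_sqrt_power of_nat_power)
  finally show ?thesis .
qed

section \<open>Edges and triangles of the random graph\<close>

lemma set_pmf_gnp: "set_pmf (gnp n p) \<subseteq> Pow (vpairs n)"
  by (auto simp: gnp_def)

lemma finite_set_pmf_gnp: "finite (set_pmf (gnp n p))"
  by (rule finite_subset[OF set_pmf_gnp]) (simp add: finite_vpairs)

lemma integrable_gnp: "integrable (measure_pmf (gnp n p)) (f :: _ \<Rightarrow> real)"
  by (rule integrable_measure_pmf_finite[OF finite_set_pmf_gnp])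

lemma prob_gnp_superset:
  assumes "0 \<le> p" "p \<le> 1" "F \<subseteq> vpairs n"
  shows "measure_pmf.prob (gnp n p) {G. F \<subseteq> G} = p ^ card F"
proof -
  have "measure_pmf.prob (gnp n p) {G. F \<subseteq> G} =
     measure_pmf.prob (Pi_pmf (vpairs n) False (\<lambda>_. bernoulli_pmf p))
       (Pi (vpairs n) (\<lambda>e. if e \<in> F then {True} else UNIV))"
    using assms(3) unfolding gnp_def measure_map_pmf
    by (intro arg_cong2[of _ _ _ _ measure]) (auto simp: Pi_def subset_iff)
  also have "\<dots> = (\<Prod>e\<in>vpairs n. if e \<in> F then p else 1)"
    using assms(1,2) by (subst measure_Pi_pmf_Pi)
      (auto simp: finite_vpairs measure_pmf_single intro!: prod.cong)
  also have "\<dots> = p ^ card F"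
    using assms(3) by (simp add: prod.If_cases finite_vpairs Int_absorb1)
  finally show ?thesis .
qed

lemma expectation_gnp_superset:
  assumes "0 \<le> p" "p \<le> 1" "F \<subseteq> vpairs n"
  shows "measure_pmf.expectation (gnp n p) (\<lambda>G. of_bool (F \<subseteq> G)) = p ^ card F"
proof -
  have "measure_pmf.expectation (gnp n p) (\<lambda>G. of_bool (F \<subseteq> G)) =
    measure_pmf.expectation (gnp n p) (indicator {G. F \<subseteq> G} :: _ \<Rightarrow> real)"
    by (intro Bochner_Integration.integral_cong) (auto simp: indicator_def)
  then show ?thesis using prob_gnp_superset[OF assms] by simp
qed

text \<open>Second moment method. For disjoint \<open>F i\<close> and \<open>F j\<close> the events
  are independent and the covariance vanishes; otherwise it is at most the joint probability. So
  \<open>B\<close> bounds the variance, and Chebyshev's inequality with deviation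
  \<open>\<mu> / 2\<close> gives the factor 4.\<close>

lemma gnp_count_lower_tail:
  fixes F :: "'i \<Rightarrow> edges"
  defines "N \<equiv> \<lambda>I G. \<Sum>i\<in>I. of_bool (F i \<subseteq> G) :: real"
  assumes p: "0 \<le> p" "p \<le> 1" and I: "finite I" "\<And>i. i \<in> I \<Longrightarrow> F i \<subseteq> vpairs n"
    and \<mu>: "\<mu> = (\<Sum>i\<in>I. p ^ card (F i))" "\<mu> > 0"
    and B: "(\<Sum>i\<in>I. \<Sum>j\<in>{j\<in>I. F i \<inter> F j \<noteq> {}}. p ^ card (F i \<union> F j)) \<le> B"
  shows "measure_pmf.prob (gnp n p) {G. N I G < \<mu> / 2} \<le> 4 * B / \<mu>\<^sup>2"
proof -
  let ?E = "measure_pmf.expectation (gnp n p)"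
  have EN: "?E (N I) = \<mu>"
    unfolding N_def \<mu>(1) using expectation_gnp_superset[OF p] I
    by (subst Bochner_Integration.integral_sum) (auto intro: integrable_gnp)
  have pair: "?E (\<lambda>G. of_bool (F i \<subseteq> G \<and> F j \<subseteq> G)) = p ^ card (F i \<union> F j)"
    if "i \<in> I" "j \<in> I" for i j
    using expectation_gnp_superset[OF p, of "F i \<union> F j" n] I(2) that by simp
  have "?E (\<lambda>G. (N I G)\<^sup>2) = ?E (\<lambda>G. \<Sum>i\<in>I. \<Sum>j\<in>I. of_bool (F i \<union> F j \<subseteq> G))"
    unfolding N_def power2_eq_square sum_product
    by (simp flip: of_bool_conj)
  also have "\<dots> = (\<Sum>i\<in>I. \<Sum>j\<in>I. p ^ card (F i \<union> F j))"
    using I pair by (simp add: integrable_gnp del: sum_of_bool_eq)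
  finally have EN2: "?E (\<lambda>G. (N I G)\<^sup>2) = (\<Sum>i\<in>I. \<Sum>j\<in>I. p ^ card (F i \<union> F j))" .
  have "(\<Sum>i\<in>I. \<Sum>j\<in>I. p ^ card (F i \<union> F j)) - \<mu>\<^sup>2 =
      (\<Sum>i\<in>I. \<Sum>j\<in>I. p ^ card (F i \<union> F j) - p ^ card (F i) * p ^ card (F j))"
    unfolding \<mu>(1) power2_eq_square sum_product by (simp add: sum_subtractf)
  also have "\<dots> \<le> (\<Sum>i\<in>I. \<Sum>j\<in>I. if F i \<inter> F j \<noteq> {} then p ^ card (F i \<union> F j) else 0)"
  proof (intro sum_mono)
    fix i j assume ij: "i \<in> I" "j \<in> I"
    have "finite (F i)" "finite (F j)"
      using I(2) ij finite_vpairs finite_subset by blast+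
    then show "p ^ card (F i \<union> F j) - p ^ card (F i) * p ^ card (F j)
        \<le> (if F i \<inter> F j \<noteq> {} then p ^ card (F i \<union> F j) else 0)"
      using p by (auto simp: card_Un_disjoint power_add)
  qed
  also have "\<dots> = (\<Sum>i\<in>I. \<Sum>j\<in>{j\<in>I. F i \<inter> F j \<noteq> {}}. p ^ card (F i \<union> F j))"
    by (intro sum.cong refl sum.inter_filter[symmetric] I)
  finally have var: "measure_pmf.variance (gnp n p) (N I) \<le> B"
    using B by (subst measure_pmf.variance_eq) (simp_all add: EN EN2 integrable_gnp)
  have "measure_pmf.prob (gnp n p) {G. N I G < \<mu> / 2}
      \<le> measure_pmf.prob (gnp n p) {G \<in> space (measure_pmf (gnp n p)). \<bar>N I G - ?E (N I)\<bar> \<ge> \<mu> / 2}"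
    unfolding EN by (intro measure_pmf.finite_measure_mono) (auto simp: abs_if)
  also have "\<dots> \<le> measure_pmf.variance (gnp n p) (N I) / (\<mu> / 2)\<^sup>2"
    by (rule measure_pmf.Chebyshev_inequality) (use \<mu> in \<open>auto intro: integrable_gnp\<close>)
  also have "\<dots> \<le> B / (\<mu> / 2)\<^sup>2"
    by (intro divide_right_mono var) auto
  finally show ?thesis by (simp add: power_divide mult.commute)
qed

lemma card_vpairs: "card (vpairs n) = n choose 2"
  using n_subsets[of "{..<n}" 2] by (simp add: vpairs_def)

text \<open>Single pairs overlap only when equal, so the variance is at most the mean. The constant
  16 combines the 4 of the lower tail bound with \<open>n choose 2\<close> being at least
  \<open>(n / 2) ^ 2\<close>.\<close>

lemma gnp_few_edges:
  assumes "0 < p" "p \<le> 1" "2 \<le> n"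
  shows "measure_pmf.prob (gnp n p) {G. real (card (G \<inter> vpairs n)) < real (n choose 2) * p / 2}
    \<le> 16 / (real n ^ 2 * p)"
proof -
  let ?M = "real (n choose 2)"
  have M: "(real n / 2) ^ 2 \<le> ?M"
    using binomial_ge_n_over_k_pow_k[of 2 n, where 'a = real] assms by simp
  have M0: "0 < (real n / 2) ^ 2" using assms by simp
  have Mpos: "0 < ?M" using M M0 by linarith
  have count: "(\<Sum>e\<in>vpairs n. of_bool ({e} \<subseteq> G)) = real (card (G \<inter> vpairs n))" for G
    by (simp add: of_bool_def sum.If_cases finite_vpairs Int_commute)
  have "(\<Sum>i\<in>vpairs n. \<Sum>j\<in>{j\<in>vpairs n. {i} \<inter> {j} \<noteq> {}}. p ^ card ({i} \<union> {j}))
      = (\<Sum>i\<in>vpairs n. p)"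
  proof (intro sum.cong refl)
    fix i assume "i \<in> vpairs n"
    then have "{j\<in>vpairs n. {i} \<inter> {j} \<noteq> {}} = {i}" by auto
    then show "(\<Sum>j\<in>{j\<in>vpairs n. {i} \<inter> {j} \<noteq> {}}. p ^ card ({i} \<union> {j})) = p" by simp
  qed
  also have "\<dots> = ?M * p" by (simp add: card_vpairs)
  finally have B: "(\<Sum>i\<in>vpairs n. \<Sum>j\<in>{j\<in>vpairs n. {i} \<inter> {j} \<noteq> {}}. p ^ card ({i} \<union> {j})) \<le> ?M * p"
    by simp
  have "measure_pmf.prob (gnp n p) {G. (\<Sum>e\<in>vpairs n. of_bool ({e} \<subseteq> G)) < ?M * p / 2}
      \<le> 4 * (?M * p) / (?M * p)\<^sup>2"
    by (rule gnp_count_lower_tail[OF _ _ _ _ _ _ B])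
      (use assms Mpos in \<open>auto simp: finite_vpairs card_vpairs\<close>)
  then have "measure_pmf.prob (gnp n p) {G. real (card (G \<inter> vpairs n)) < ?M * p / 2}
      \<le> 4 * (?M * p) / (?M * p)\<^sup>2"
    by (simp only: count)
  also have "\<dots> = 4 / (?M * p)" using Mpos assms by (simp add: power2_eq_square)
  also have "\<dots> \<le> 4 / ((real n / 2) ^ 2 * p)"
    using M M0 assms by (intro divide_left_mono mult_right_mono mult_pos_pos) auto
  also have "\<dots> = 16 / (real n ^ 2 * p)" by (simp add: power_divide)
  finally show ?thesis .
qed

section \<open>Triangles of the random graph\<close>

definition pairs_of :: "'a set \<Rightarrow> 'a set set" where
  "pairs_of t = {e. e \<subseteq> t \<and> card e = 2}"

lemma triangles_eq: "triangles E = {t. card t = 3 \<and> pairs_of t \<subseteq> E}"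
proof -
  have "(\<forall>u\<in>t. \<forall>v\<in>t. u \<noteq> v \<longrightarrow> {u, v} \<in> E) \<longleftrightarrow> pairs_of t \<subseteq> E" for t :: "nat set"
    by (fastforce simp: pairs_of_def card_2_iff)
  then show ?thesis by (auto simp: triangles_def)
qed

lemma triangles_subset:
  assumes "E \<subseteq> vpairs n" "t \<in> triangles E"
  shows "t \<subseteq> {..<n}"
proof
  fix u assume u: "u \<in> t"
  have "card t = 3" using assms(2) by (simp add: triangles_def)
  then obtain v where "v \<in> t" "v \<noteq> u" by (auto simp: card_3_iff)
  then have "{u, v} \<in> vpairs n" using assms u by (auto simp: triangles_def)
  then show "u \<in> {..<n}" by (simp add: vpairs_def)
qed

lemma finite_triangles: "E \<subseteq> vpairs n \<Longrightarrow> finite (triangles E)"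
  by (rule finite_subset[of _ "Pow {..<n}"]) (auto dest: triangles_subset)

lemma card_pairs_of: "finite t \<Longrightarrow> card (pairs_of t) = card t choose 2"
  unfolding pairs_of_def by (rule n_subsets)

text \<open>Second moment method for the triples of vertices: a triple overlaps itself, with weight
  \<open>p ^ 3\<close>, and at most \<open>3 * n\<close> others, with weight at most
  \<open>p ^ 5\<close> each.\<close>

lemma gnp_no_triangle:
  assumes "0 < p" "p \<le> 1" "3 \<le> n"
  shows "measure_pmf.prob (gnp n p) {G. num_triangles G = 0}
    \<le> 108 / (real n * p) ^ 3 + 324 / (real n ^ 2 * p)"
proof -
  let ?M = "real (n choose 3)"
  define I where "I = {t. t \<subseteq> {..<n} \<and> card t = 3}"
  have I: "finite I" by (rule finite_subset[of _ "Pow {..<n}"]) (auto simp: I_def)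
  have cI: "card I = n choose 3" using n_subsets[of "{..<n}" 3] by (simp add: I_def)
  have c3: "card (pairs_of t) = 3" "finite t" "finite (pairs_of t)" if "t \<in> I" for t
  proof -
    show "finite t" using that by (auto simp: I_def intro: card_ge_0_finite)
    then show "finite (pairs_of t)" by (auto simp: pairs_of_def)
    show "card (pairs_of t) = 3" using card_pairs_of[OF \<open>finite t\<close>] that
      by (simp add: I_def choose_two)
  qed
  have M: "(real n / 3) ^ 3 \<le> ?M"
    using binomial_ge_n_over_k_pow_k[of 3 n, where 'a = real] assms by simp
  have M0: "0 < (real n / 3) ^ 3" using assms by simp
  have Mpos: "0 < ?M" using M M0 by linarith
  have inner: "(\<Sum>j\<in>{j\<in>I. pairs_of i \<inter> pairs_of j \<noteq> {}}. p ^ card (pairs_of i \<union> pairs_of j))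
      \<le> p ^ 3 + 3 * real n * p ^ 5" if i: "i \<in> I" for i
  proof -
    let ?J = "{j\<in>I. pairs_of i \<inter> pairs_of j \<noteq> {}}"
    have fJ: "finite ?J" using I by auto
    \<comment> \<open>Another triple sharing a pair \<open>e\<close> with \<open>i\<close> is
      \<open>e\<close> with one more vertex: three choices for \<open>e\<close> and at most
      \<open>n\<close> for the vertex.\<close>
    have "?J - {i} \<subseteq> (\<lambda>(e, w). insert w e) ` (pairs_of i \<times> {..<n})"
    proof
      fix j assume j: "j \<in> ?J - {i}"
      then obtain e where e: "e \<in> pairs_of i" "e \<subseteq> j" "card e = 2"
        by (auto simp: pairs_of_def)
      have "card (j - e) = 1" using e j by (subst card_Diff_subset) 
          (auto simp: I_def intro: card_ge_0_finite)
      then obtain w where "j - e = {w}" by (auto simp: card_1_singleton_iff)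
      then have "j = insert w e" "w \<in> j" using e by auto
      then show "j \<in> (\<lambda>(e, w). insert w e) ` (pairs_of i \<times> {..<n})"
        using e j by (auto simp: I_def)
    qed
    then have "card (?J - {i}) \<le> card ((\<lambda>(e, w). insert w e) ` (pairs_of i \<times> {..<n}))"
      by (rule card_mono[rotated]) (use c3[OF i] in auto)
    also have "\<dots> \<le> card (pairs_of i \<times> {..<n})"
      by (rule card_image_le) (use c3[OF i] in auto)
    also have "\<dots> = 3 * n" using c3[OF i] by simp
    finally have cJ: "card (?J - {i}) \<le> 3 * n" .
    \<comment> \<open>Distinct triples have at most one pair in common, hence at least 3 + 3 - 1 = 5
      pairs together.\<close>
    have five: "p ^ card (pairs_of i \<union> pairs_of j) \<le> p ^ 5" if j: "j \<in> ?J - {i}" for j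
    proof -
      have jI: "j \<in> I" and "j \<noteq> i" using j by auto
      have fin: "finite (i \<inter> j)" using c3[OF i] by simp
      have "i \<inter> j \<noteq> i"
        using \<open>j \<noteq> i\<close> i jI c3[OF jI] by (auto simp: I_def dest: card_subset_eq)
      then have "card (i \<inter> j) < 3"
        using psubset_card_mono[of i "i \<inter> j"] c3[OF i] i by (auto simp: I_def)
      then have "pairs_of i \<inter> pairs_of j \<subseteq> {i \<inter> j}"
        using card_seteq[OF fin] by (force simp: pairs_of_def)
      then have "card (pairs_of i \<inter> pairs_of j) \<le> 1"
        using card_mono[of "{i \<inter> j}"] by auto
      then have "5 \<le> card (pairs_of i \<union> pairs_of j)"
        using card_Un_Int[of "pairs_of i" "pairs_of j"] c3[OF i] c3[OF jI] by linarith
      then show ?thesis using assms by (intro power_decreasing) auto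
    qed
    have "(\<Sum>j\<in>?J. p ^ card (pairs_of i \<union> pairs_of j))
        \<le> (\<Sum>j\<in>insert i (?J - {i}). p ^ card (pairs_of i \<union> pairs_of j))"
      by (rule sum_mono2) (use fJ assms in auto)
    also have "\<dots> = p ^ 3 + (\<Sum>j\<in>?J - {i}. p ^ card (pairs_of i \<union> pairs_of j))"
      using fJ c3[OF i] by (subst sum.insert) auto
    also have "(\<Sum>j\<in>?J - {i}. p ^ card (pairs_of i \<union> pairs_of j)) \<le> real (card (?J - {i})) * p ^ 5"
      using five by (intro sum_bounded_above) auto
    also have "\<dots> \<le> real (3 * n) * p ^ 5"
      using cJ assms by (intro mult_right_mono) auto
    finally show ?thesis by simp
  qed
  have B: "(\<Sum>i\<in>I. \<Sum>j\<in>{j\<in>I. pairs_of i \<inter> pairs_of j \<noteq> {}}. p ^ card (pairs_of i \<union> pairs_of j))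
      \<le> ?M * (p ^ 3 + 3 * real n * p ^ 5)"
    using sum_bounded_above[of I, OF inner] cI by simp
  have "measure_pmf.prob (gnp n p) {G. num_triangles G = 0}
     \<le> measure_pmf.prob (gnp n p) {G. (\<Sum>t\<in>I. of_bool (pairs_of t \<subseteq> G)) < ?M * p ^ 3 / 2}"
  proof (rule measure_pmf.finite_measure_mono_AE)
    show "AE G in measure_pmf (gnp n p). G \<in> {G. num_triangles G = 0} \<longrightarrow>
       G \<in> {G. (\<Sum>t\<in>I. of_bool (pairs_of t \<subseteq> G)) < ?M * p ^ 3 / 2}"
    proof (rule AE_pmfI, rule impI)
      fix G assume G: "G \<in> set_pmf (gnp n p)" "G \<in> {G. num_triangles G = 0}"
      have "finite (triangles G)"
        using G(1) set_pmf_gnp by (intro finite_triangles) blast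
      then have "triangles G = {}"
        using G(2) by (simp add: num_triangles_def)
      then have "(\<Sum>t\<in>I. of_bool (pairs_of t \<subseteq> G)) = (0::real)"
        by (intro sum.neutral) (auto simp: triangles_eq I_def)
      then show "G \<in> {G. (\<Sum>t\<in>I. of_bool (pairs_of t \<subseteq> G)) < ?M * p ^ 3 / 2}"
        using Mpos assms by simp
    qed
  qed simp
  also have "\<dots> \<le> 4 * (?M * (p ^ 3 + 3 * real n * p ^ 5)) / (?M * p ^ 3)\<^sup>2"
  proof (rule gnp_count_lower_tail[OF _ _ I _ _ _ B])
    show "pairs_of t \<subseteq> vpairs n" if "t \<in> I" for t
      using that by (auto simp: pairs_of_def vpairs_def I_def)
  qed (use assms Mpos in \<open>auto simp: c3 cI\<close>)
  also have "\<dots> = 4 * (1 + 3 * real n * p ^ 2) / (?M * p ^ 3)"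
  proof -
    have "p ^ 5 = p ^ 3 * p ^ 2" by (simp flip: power_add)
    then have "?M * (p ^ 3 + 3 * real n * p ^ 5) = (?M * p ^ 3) * (1 + 3 * real n * p ^ 2)"
      by (simp add: algebra_simps)
    moreover have "4 * (x * y) / x\<^sup>2 = 4 * y / x" if "x \<noteq> 0" for x y :: real
      using that by (simp add: power2_eq_square)
    moreover have "?M * p ^ 3 \<noteq> 0" using Mpos assms by simp
    ultimately show ?thesis by metis
  qed
  \<comment> \<open>Bounding \<open>n choose 3\<close> below by \<open>(n / 3) ^ 3\<close> costs a
    factor 27, which turns 4 and 12 into 108 and 324.\<close>
  also have "\<dots> \<le> 4 * (1 + 3 * real n * p ^ 2) / ((real n / 3) ^ 3 * p ^ 3)"
    using M M0 assms by (intro divide_left_mono mult_right_mono mult_pos_pos) auto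
  also have "\<dots> = 108 / (real n * p) ^ 3 + 324 / (real n ^ 2 * p)"
  proof -
    have "4 * (1 + 3 * x * p ^ 2) / ((x / 3) ^ 3 * p ^ 3) = 108 / (x * p) ^ 3 + 324 / (x ^ 2 * p)"
      if "x > 0" for x :: real
      using that assms(1) by (simp add: divide_simps power2_eq_square power3_eq_cube)
    then show ?thesis using assms(3) by simp
  qed
  finally show ?thesis .
qed

section \<open>Indistinguishable inputs\<close>

lemma vpairs_Union_subset: "S \<subseteq> vpairs n \<Longrightarrow> \<Union> S \<subseteq> {..<n}"
  by (auto simp: vpairs_def)

lemma finite_subset_vpairs: "S \<subseteq> vpairs n \<Longrightarrow> finite S"
  using finite_vpairs finite_subset by blast

text \<open>Pigeonhole: two of three vertices lie on the same side of \<open>W\<close>, and an edge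
  between them is not cut.\<close>

lemma triangles_cut_edges: "triangles (cut_edges W E) = {}"
proof -
  have False if t: "t \<in> triangles (cut_edges W E)" for t
  proof -
    obtain a b c where abc: "t = {a, b, c}" "a \<noteq> b" "b \<noteq> c" "a \<noteq> c"
      using t by (auto simp: triangles_def card_3_iff)
    have "card ({u, v} \<inter> W) = 1" if "u \<in> t" "v \<in> t" "u \<noteq> v" for u v
      using t that by (auto simp: triangles_def cut_edges_def)
    then have "(u \<in> W) \<noteq> (v \<in> W)" if "u \<in> t" "v \<in> t" "u \<noteq> v" for u v
      using card_doubleton_Int_eq_1 that by metis
    then show False using abc by (metis insertCI)
  qed
  then show ?thesis by blast
qed

lemma triangles_uncut:
  assumes "t \<in> triangles E" "t \<subseteq> W \<or> t \<inter> W = {}"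
  shows "t \<in> triangles (E - cut_edges W E)"
proof -
  have "card ({u, v} \<inter> W) \<noteq> 1" if "u \<in> t" "v \<in> t" "u \<noteq> v" for u v
    using that assms(2) card_doubleton_Int_eq_1[of u v W] by auto
  then show ?thesis using assms(1) by (auto simp: triangles_def cut_edges_def)
qed

text \<open>Of the eight placements of three vertices relative to \<open>W\<close>, two keep them
  together.\<close>

lemma card_uncut_triple:
  assumes "finite V" "t \<subseteq> V" "card t = 3"
  shows "4 * card {W \<in> Pow V. t \<subseteq> W \<or> t \<inter> W = {}} = 2 ^ card V"
proof -
  have ft: "finite t" "t \<noteq> {}" using assms by (auto intro: card_ge_0_finite)
  have eq: "{W \<in> Pow V. t \<subseteq> W \<or> t \<inter> W = {}} = (\<union>) t ` Pow (V - t) \<union> Pow (V - t)"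
  proof (intro equalityI subsetI)
    fix W assume W: "W \<in> {W \<in> Pow V. t \<subseteq> W \<or> t \<inter> W = {}}"
    then have "W = t \<union> (W - t) \<and> W - t \<in> Pow (V - t) \<or> W \<in> Pow (V - t)" by blast
    then show "W \<in> (\<union>) t ` Pow (V - t) \<union> Pow (V - t)" by blast
  qed (use assms(2) in auto)
  have inj: "inj_on ((\<union>) t) (Pow (V - t))" by (rule inj_onI) blast
  have cd: "card (V - t) = card V - 3" "3 \<le> card V"
    using assms ft card_mono[OF assms(1,2)] by (auto simp: card_Diff_subset)
  have "card {W \<in> Pow V. t \<subseteq> W \<or> t \<inter> W = {}} = 2 ^ (card V - 3) + 2 ^ (card V - 3)"
    unfolding eq using assms(1) ft(2) inj
    by (subst card_Un_disjoint) (auto simp: card_image card_Pow cd)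
  moreover have "(2::nat) ^ card V = 2 ^ (card V - 3) * 2 ^ 3"
    using cd(2) by (simp only: flip: power_add) simp
  ultimately show ?thesis by simp
qed

text \<open>Double counting of the pairs of a triangle and a vertex set that does not separate
  it.\<close>

lemma sum_num_triangles_uncut_ge:
  assumes "E \<subseteq> vpairs n"
  shows "2 ^ n * real (num_triangles E)
    \<le> 4 * (\<Sum>W\<in>Pow {..<n}. real (num_triangles (E - cut_edges W E)))"
proof -
  let ?tr = "\<lambda>W. triangles (E - cut_edges W E)"
  have fin: "finite (triangles E)" by (rule finite_triangles[OF assms])
  have "2 ^ n * num_triangles E
      = (\<Sum>t\<in>triangles E. 4 * card {W \<in> Pow {..<n}. t \<subseteq> W \<or> t \<inter> W = {}})"
  proof -
    have "4 * card {W \<in> Pow {..<n}. t \<subseteq> W \<or> t \<inter> W = {}} = 2 ^ n" if "t \<in> triangles E" for t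
      using card_uncut_triple[of "{..<n}" t] triangles_subset[OF assms that] that
      by (simp add: triangles_def)
    then show ?thesis by (simp add: num_triangles_def)
  qed
  also have "\<dots> \<le> (\<Sum>t\<in>triangles E. 4 * card {W \<in> Pow {..<n}. t \<in> ?tr W})"
    by (intro sum_mono mult_left_mono card_mono) (auto intro: triangles_uncut)
  also have "\<dots> = 4 * (\<Sum>t\<in>triangles E. \<Sum>W\<in>Pow {..<n}. of_bool (t \<in> ?tr W))"
    by (simp add: sum_distrib_left Int_def)
  also have "\<dots> = 4 * (\<Sum>W\<in>Pow {..<n}. \<Sum>t\<in>triangles E. of_bool (t \<in> ?tr W))"
    by (subst sum.swap) simp
  also have "\<dots> = 4 * (\<Sum>W\<in>Pow {..<n}. num_triangles (E - cut_edges W E))"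
  proof -
    have "triangles E \<inter> {t. t \<in> ?tr W} = ?tr W" for W by (auto simp: triangles_def)
    then show ?thesis using fin by (simp add: num_triangles_def)
  qed
  finally have "real (2 ^ n * num_triangles E)
      \<le> real (4 * (\<Sum>W\<in>Pow {..<n}. num_triangles (E - cut_edges W E)))"
    by (rule of_nat_mono)
  then show ?thesis by simp
qed

text \<open>Reverse Markov: the number of uncut triangles averages at least a quarter of its maximum.\<close>

lemma many_uncut_triangles:
  assumes "E \<subseteq> vpairs n" "0 < T" "T \<le> real (num_triangles E)" "0 \<le> \<epsilon>"
  shows "(1 / 4 - 2 * \<epsilon>) * 2 ^ n
    \<le> card {W \<in> Pow {..<n}. 2 * \<epsilon> * T < num_triangles (E - cut_edges W E)}"
proof -
  let ?B = "{W \<in> Pow {..<n}. 2 * \<epsilon> * T < num_triangles (E - cut_edges W E)}"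
  let ?N = "real (num_triangles E)"
  have le: "real (num_triangles (E - cut_edges W E)) \<le> ?N" for W
    unfolding num_triangles_def
    by (intro of_nat_mono card_mono finite_triangles[OF assms(1)]) (auto simp: triangles_def)
  have "2 ^ n * ?N \<le> 4 * (\<Sum>W\<in>Pow {..<n}. real (num_triangles (E - cut_edges W E)))"
    by (rule sum_num_triangles_uncut_ge[OF assms(1)])
  \<comment> \<open>A set in \<open>?B\<close> keeps at most all \<open>?N\<close> triangles; any
    other set keeps at most \<open>2 * \<epsilon> * T\<close>, which is at most
    \<open>2 * \<epsilon> * ?N\<close>.\<close>
  also have "\<dots> \<le> 4 * (\<Sum>W\<in>Pow {..<n}. ?N * of_bool (W \<in> ?B) + 2 * \<epsilon> * ?N)"
  proof (intro mult_left_mono sum_mono)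
    fix W assume W: "W \<in> Pow {..<n}"
    have "2 * \<epsilon> * T \<le> 2 * \<epsilon> * ?N" "0 \<le> 2 * \<epsilon> * ?N"
      using assms by (auto intro: mult_left_mono)
    then show "real (num_triangles (E - cut_edges W E)) \<le> ?N * of_bool (W \<in> ?B) + 2 * \<epsilon> * ?N"
      using le[of W] W by (cases "W \<in> ?B") auto
  qed simp
  also have "\<dots> = 4 * (?N * card ?B + 2 ^ n * (2 * \<epsilon> * ?N))"
  proof -
    have "Pow {..<n} \<inter> {W. W \<in> ?B} = ?B" by auto
    then show ?thesis
      by (simp add: sum.distrib card_Pow flip: sum_distrib_left del: mem_Collect_eq)
  qed
  finally have "?N * ((1 / 4 - 2 * \<epsilon>) * 2 ^ n) \<le> ?N * card ?B"
    by (simp add: algebra_simps)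
  moreover have "0 < ?N" using assms by simp
  ultimately show ?thesis by (simp only: mult_le_cancel_left_pos)
qed

section \<open>Runs of the algorithm on the cut and uncut parts\<close>

lemma prob_run_alg:
  assumes "set_pmf D \<subseteq> Pow (vpairs n)"
  shows "measure_pmf.prob (run_alg D A E) X
    = (\<Sum>S\<in>Pow (vpairs n). pmf D S * measure_pmf.prob (A S (E \<inter> S)) X)"
proof -
  have fin: "finite (set_pmf D)"
    by (rule finite_subset[OF assms]) (simp add: finite_vpairs)
  have "ennreal (measure_pmf.prob (run_alg D A E) X)
      = (\<integral>\<^sup>+S. ennreal (measure_pmf.prob (A S (E \<inter> S)) X) \<partial>measure_pmf D)"
    unfolding run_alg_def by (simp flip: measure_pmf.emeasure_eq_measure)
  also have "\<dots> = ennreal (measure_pmf.expectation D (\<lambda>S. measure_pmf.prob (A S (E \<inter> S)) X))"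
    by (intro nn_integral_eq_integral integrable_measure_pmf_finite fin) auto
  finally have "measure_pmf.prob (run_alg D A E) X
      = measure_pmf.expectation D (\<lambda>S. measure_pmf.prob (A S (E \<inter> S)) X)"
    by (simp add: integral_nonneg_AE)
  also have "\<dots> = (\<Sum>S\<in>Pow (vpairs n). measure_pmf.prob (A S (E \<inter> S)) X * pmf D S)"
    by (rule integral_measure_pmf_real) (use assms in \<open>auto simp: finite_vpairs\<close>)
  finally show ?thesis by (simp add: mult.commute)
qed

lemma sample_cost_eq:
  assumes "set_pmf D \<subseteq> Pow (vpairs n)"
  shows "sample_cost D E = (\<Sum>S\<in>Pow (vpairs n). pmf D S * card (E \<inter> S))"
  unfolding sample_cost_def
  by (subst integral_measure_pmf_real[of "Pow (vpairs n)"])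
    (use assms in \<open>auto simp: finite_vpairs mult.commute\<close>)

text \<open>The pulled-back edges form the required subgraph. Hence a solver must be correct on
  every subgraph of a relabelled copy, in particular on its cut and uncut parts.\<close>

lemma subgraph_graph_iso:
  assumes "graph_iso n G G1" "G' \<subseteq> G1"
  shows "\<exists>H\<subseteq>G. graph_iso n H G'"
proof -
  obtain \<pi> where \<pi>: "bij_betw \<pi> {..<n} {..<n}" "G1 = (\<lambda>e. \<pi> ` e) ` G"
    using assms(1) by (auto simp: graph_iso_def)
  have "G' = (\<lambda>e. \<pi> ` e) ` {e \<in> G. \<pi> ` e \<in> G'}" using assms(2) \<pi>(2) by blast
  then have "graph_iso n {e \<in> G. \<pi> ` e \<in> G'} G'"
    unfolding graph_iso_def using \<pi>(1) by blast
  then show ?thesis by (intro exI[of _ "{e \<in> G. \<pi> ` e \<in> G'}"]) auto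
qed

lemma num_triangles_graph_iso_le:
  assumes "graph_iso n G G1" "G \<subseteq> vpairs n"
  shows "num_triangles G \<le> num_triangles G1"
proof -
  obtain \<pi> where \<pi>: "bij_betw \<pi> {..<n} {..<n}" "G1 = (\<lambda>e. \<pi> ` e) ` G"
    using assms(1) by (auto simp: graph_iso_def)
  have inj: "inj_on \<pi> {..<n}" using \<pi>(1) by (simp add: bij_betw_def)
  show ?thesis unfolding num_triangles_def
  proof (rule card_inj_on_le)
    show "inj_on ((`) \<pi>) (triangles G)"
      by (rule inj_on_subset[OF inj_on_image_Pow[OF inj]]) (use triangles_subset[OF assms(2)] in blast)
    show "(`) \<pi> ` triangles G \<subseteq> triangles G1"
    proof safe
      fix t assume t: "t \<in> triangles G"
      have "inj_on \<pi> t" using inj triangles_subset[OF assms(2) t] by (rule inj_on_subset)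
      then have "card (\<pi> ` t) = 3" using t by (simp add: card_image triangles_def)
      moreover have "{\<pi> u, \<pi> v} \<in> G1" if "u \<in> t" "v \<in> t" "\<pi> u \<noteq> \<pi> v" for u v
      proof -
        have "{u, v} \<in> G" using that t by (auto simp: triangles_def)
        then have "\<pi> ` {u, v} \<in> G1" using \<pi>(2) by blast
        then show ?thesis by simp
      qed
      ultimately show "\<pi> ` t \<in> triangles G1" by (auto simp: triangles_def)
    qed
    show "finite (triangles G1)"
      by (rule finite_triangles[OF graph_iso_vpairs[OF assms(2,1)]])
  qed
qed

text \<open>The interval \<open>?I\<close> holds the answers that are correct for a triangle-free
  input. It is hit with probability at least 9/10 on every cut part, but at most 1/10 on an uncut
  part with many triangles. Averaged over \<open>W\<close>, a query with an acyclic view contributes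
  equally to both sides, so queries that see a cycle account for the whole gap.\<close>

lemma solves_imp_cycle_prob_ge:
  assumes sol: "solves n G \<epsilon> (1 / 10) s D A" and G: "G \<subseteq> vpairs n" "num_triangles G > 0"
    and iso: "graph_iso n G G1" and \<epsilon>: "0 \<le> \<epsilon>"
  shows "1 / 8 - 2 * \<epsilon> \<le> (\<Sum>S\<in>Pow (vpairs n). pmf D S * of_bool (has_cycle (G1 \<inter> S)))"
proof -
  let ?T = "real (num_triangles G)"
  let ?I = "{- \<epsilon> * ?T .. \<epsilon> * ?T}"
  let ?V = "Pow {..<n}"
  let ?PS = "Pow (vpairs n)"
  let ?P = "\<lambda>E. measure_pmf.prob (run_alg D A E) ?I"
  define q where "q = (\<lambda>S E. measure_pmf.prob (A S E) ?I)"
  define c where "c = (\<Sum>S\<in>?PS. pmf D S * of_bool (has_cycle (G1 \<inter> S)))"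
  have D: "set_pmf D \<subseteq> ?PS" using sol by (simp add: solves_def)
  have G1: "G1 \<subseteq> vpairs n" by (rule graph_iso_vpairs[OF G(1) iso])
  have correct: "9 / 10 \<le> measure_pmf.prob (run_alg D A E)
      {real (num_triangles E) - \<epsilon> * ?T .. real (num_triangles E) + \<epsilon> * ?T}" if "E \<subseteq> G1" for E
    using sol subgraph_graph_iso[OF iso that] unfolding solves_def by auto
  have P_eq: "?P E = (\<Sum>S\<in>?PS. pmf D S * q S (E \<inter> S))" for E
    unfolding q_def by (rule prob_run_alg[OF D])
  have q01: "0 \<le> q S E" "q S E \<le> 1" for S E by (auto simp: q_def)
  let ?B = "{W \<in> ?V. 2 * \<epsilon> * ?T < num_triangles (G1 - cut_edges W G1)}"
  have cut: "9 / 10 \<le> ?P (cut_edges W G1)" for W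
    using correct[OF cut_edges_subset] by (simp add: num_triangles_def triangles_cut_edges)
  have uncut: "?P (G1 - cut_edges W G1) \<le> 1 - 9 / 10 * of_bool (W \<in> ?B)" if W: "W \<in> ?V" for W
  proof (cases "W \<in> ?B")
    case True
    let ?E = "G1 - cut_edges W G1"
    let ?J = "{real (num_triangles ?E) - \<epsilon> * ?T .. real (num_triangles ?E) + \<epsilon> * ?T}"
    \<comment> \<open>More than \<open>2 * \<epsilon> * ?T\<close> triangles put the interval of
      correct answers entirely above \<open>?I\<close>.\<close>
    have "?I \<inter> ?J = {}" using True by auto
    then have "?P ?E + measure_pmf.prob (run_alg D A ?E) ?J
        = measure_pmf.prob (run_alg D A ?E) (?I \<union> ?J)"
      by (intro measure_pmf.finite_measure_Union[symmetric]) auto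
    also have "\<dots> \<le> 1" by simp
    finally show ?thesis using True correct[of ?E] by simp
  next
    case False
    then show ?thesis by (simp only: of_bool_eq mult_zero_right diff_zero measure_pmf.prob_le_1)
  qed
  have bound: "(\<Sum>W\<in>?V. q S (cut_edges W G1 \<inter> S))
      \<le> (\<Sum>W\<in>?V. q S ((G1 - cut_edges W G1) \<inter> S)) + 2 ^ n * of_bool (has_cycle (G1 \<inter> S))" for S
  proof (cases "has_cycle (G1 \<inter> S)")
    case True
    have "(\<Sum>W\<in>?V. q S (cut_edges W G1 \<inter> S)) \<le> of_nat (card ?V) * 1"
      by (rule sum_bounded_above) (rule q01)
    moreover have "0 \<le> (\<Sum>W\<in>?V. q S ((G1 - cut_edges W G1) \<inter> S))"
      by (intro sum_nonneg q01)
    ultimately show ?thesis using True by (simp add: card_Pow)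
  next
    case False
    \<comment> \<open>Cutting commutes with restricting to \<open>S\<close>, so both views come from
      the acyclic set \<open>G1 \<inter> S\<close>, where the flip applies.\<close>
    have "cut_edges W G1 \<inter> S = cut_edges W (G1 \<inter> S)"
      "(G1 - cut_edges W G1) \<inter> S = G1 \<inter> S - cut_edges W (G1 \<inter> S)" for W
      by (auto simp: cut_edges_def)
    moreover have "(\<Sum>W\<in>?V. q S (cut_edges W (G1 \<inter> S)))
        = (\<Sum>W\<in>?V. q S (G1 \<inter> S - cut_edges W (G1 \<inter> S)))"
      by (rule sum_cut_edges_eq_sum_uncut)
        (use G1 False finite_subset_vpairs[OF G1] in \<open>auto simp: vpairs_def\<close>)
    ultimately show ?thesis using False by simp
  qed
  have "(9 / 10 * 2 ^ n :: real) = (\<Sum>W\<in>?V. 9 / 10)" by (simp add: card_Pow)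
  also have "\<dots> \<le> (\<Sum>W\<in>?V. ?P (cut_edges W G1))"
    by (intro sum_mono cut)
  also have "\<dots> = (\<Sum>S\<in>?PS. pmf D S * (\<Sum>W\<in>?V. q S (cut_edges W G1 \<inter> S)))"
    unfolding P_eq by (subst sum.swap) (simp add: sum_distrib_left)
  also have "\<dots> \<le> (\<Sum>S\<in>?PS. pmf D S * ((\<Sum>W\<in>?V. q S ((G1 - cut_edges W G1) \<inter> S))
      + 2 ^ n * of_bool (has_cycle (G1 \<inter> S))))"
    by (intro sum_mono mult_left_mono bound) auto
  also have "\<dots> = (\<Sum>S\<in>?PS. \<Sum>W\<in>?V. pmf D S * q S ((G1 - cut_edges W G1) \<inter> S)) + 2 ^ n * c"
    unfolding c_def distrib_left sum.distrib
    by (intro arg_cong2[of _ _ _ _ "(+)"]) (simp_all only: sum_distrib_left mult.left_commute)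
  also have "(\<Sum>S\<in>?PS. \<Sum>W\<in>?V. pmf D S * q S ((G1 - cut_edges W G1) \<inter> S))
      = (\<Sum>W\<in>?V. ?P (G1 - cut_edges W G1))"
    unfolding P_eq by (rule sum.swap)
  also have "\<dots> \<le> (\<Sum>W\<in>?V. 1 - 9 / 10 * of_bool (W \<in> ?B))"
    by (intro sum_mono uncut)
  also have "\<dots> = 2 ^ n - 9 / 10 * card ?B"
  proof -
    have "?V \<inter> {W. W \<in> ?B} = ?B" by auto
    then have "(\<Sum>W\<in>?V. of_bool (W \<in> ?B)) = real (card ?B)"
      by (subst sum_of_bool_eq) (simp_all only: finite_Pow_iff finite_lessThan)
    moreover have "(\<Sum>W\<in>?V. 1 - 9 / 10 * f W) = 2 ^ n - 9 / 10 * (\<Sum>W\<in>?V. f W)"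
      for f :: "nat set \<Rightarrow> real"
      by (simp add: sum_subtractf sum_distrib_left card_Pow)
    ultimately show ?thesis by (simp only:)
  qed
  finally have "9 / 10 * 2 ^ n \<le> 2 ^ n - 9 / 10 * real (card ?B) + 2 ^ n * c" by simp
  moreover have "(1 / 4 - 2 * \<epsilon>) * 2 ^ n \<le> real (card ?B)"
    using num_triangles_graph_iso_le[OF iso G(1)] G(2) \<epsilon>
    by (intro many_uncut_triangles[OF G1]) auto
  ultimately have "9 / 10 * 2 ^ n \<le> 2 ^ n - 9 / 10 * ((1 / 4 - 2 * \<epsilon>) * 2 ^ n) + 2 ^ n * c"
    by linarith
  then have "2 ^ n * (9 / 10) \<le> 2 ^ n * (1 - 9 / 10 * (1 / 4 - 2 * \<epsilon>) + c)"
    by (simp add: algebra_simps)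
  then have "9 / 10 \<le> 1 - 9 / 10 * (1 / 4 - 2 * \<epsilon>) + c"
    by (subst (asm) mult_le_cancel_left_pos) auto
  \<comment> \<open>Here 9/10 * 1/4 - 1/10 = 1/8, and the coefficient 9/5 of
    \<open>\<epsilon>\<close> is rounded up to 2.\<close>
  then have "1 / 8 - 2 * \<epsilon> \<le> c" using \<epsilon> by (simp add: field_simps)
  then show ?thesis by (simp only: c_def)
qed

section \<open>Random relabelling\<close>

definition perms :: "nat \<Rightarrow> (nat \<Rightarrow> nat) set" where
  "perms n = {\<pi>. \<pi> permutes {..<n}}"

lemma finite_perms: "finite (perms n)"
  by (simp add: perms_def finite_permutations)

lemma card_perms: "card (perms n) = fact n"
  unfolding perms_def by (rule card_permutations) auto

text \<open>Followed by the remaining vertices, \<open>vs\<close> is a rearrangement of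
  \<open>[0..<n]\<close>. This serves to carry a standard pair or cycle to any given one.\<close>

lemma perms_extending_list:
  assumes "distinct vs" "set vs \<subseteq> {..<n}"
  shows "\<exists>\<sigma>\<in>perms n. map \<sigma> [0..<length vs] = vs"
proof -
  define rest where "rest = sorted_list_of_set ({..<n} - set vs)"
  have "mset (vs @ rest) = mset [0..<n]"
  proof (subst set_eq_iff_mset_eq_distinct[symmetric])
    show "set (vs @ rest) = set [0..<n]" using assms(2) by (auto simp: rest_def)
  qed (use assms in \<open>auto simp: rest_def\<close>)
  then obtain \<sigma> where \<sigma>: "\<sigma> permutes {..<length [0..<n]}" "permute_list \<sigma> [0..<n] = vs @ rest"
    by (rule mset_eq_permutation)
  have "length vs \<le> n"
    using \<sigma>(2) by (metis length_append length_permute_list length_upt diff_zero le_add1)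
  have "map \<sigma> [0..<length vs] = vs"
  proof (rule nth_equalityI)
    fix i assume "i < length (map \<sigma> [0..<length vs])"
    then have i: "i < length vs" by simp
    then have "permute_list \<sigma> [0..<n] ! i = \<sigma> i"
      using \<sigma>(1) \<open>length vs \<le> n\<close> permutes_in_image[OF \<sigma>(1), of i]
      by (simp add: permute_list_nth)
    then show "map \<sigma> [0..<length vs] ! i = vs ! i"
      using i \<sigma>(2) by (simp add: nth_append)
  qed simp
  then show ?thesis using \<sigma>(1) by (auto simp: perms_def)
qed

text \<open>Right translation by \<open>\<sigma>\<close> is a bijection of the symmetric group, so a
  uniformly random permutation stays uniform.\<close>

lemma card_perms_compose:
  assumes "\<sigma> \<in> perms n"
  shows "card {\<pi> \<in> perms n. P (\<pi> \<circ> \<sigma>)} = card {\<pi> \<in> perms n. P \<pi>}"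
proof (rule bij_betw_same_card[of "\<lambda>\<pi>. \<pi> \<circ> \<sigma>"], rule bij_betwI[where g = "\<lambda>\<pi>. \<pi> \<circ> inv \<sigma>"])
  have \<sigma>: "\<sigma> permutes {..<n}" using assms by (simp add: perms_def)
  note inv = permutes_inv_o[OF \<sigma>]
  show "(\<lambda>\<pi>. \<pi> \<circ> \<sigma>) \<in> {\<pi> \<in> perms n. P (\<pi> \<circ> \<sigma>)} \<rightarrow> {\<pi> \<in> perms n. P \<pi>}"
    using permutes_compose[OF \<sigma>] by (auto simp: perms_def)
  show "(\<lambda>\<pi>. \<pi> \<circ> inv \<sigma>) \<in> {\<pi> \<in> perms n. P \<pi>} \<rightarrow> {\<pi> \<in> perms n. P (\<pi> \<circ> \<sigma>)}"
    using permutes_compose[OF permutes_inv[OF \<sigma>]] by (auto simp: perms_def comp_assoc inv)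
qed (auto simp: comp_assoc permutes_inv_o[OF assms[unfolded perms_def mem_Collect_eq]])

text \<open>Taking preimages lets a pair be tested by looking up its image under
  \<open>\<pi>\<close> in \<open>G\<close>. For a permutation the result is the image of
  \<open>G\<close> under \<open>inv \<pi>\<close>.\<close>

definition relabel :: "nat \<Rightarrow> (nat \<Rightarrow> nat) \<Rightarrow> edges \<Rightarrow> edges" where
  "relabel n \<pi> G = {e \<in> vpairs n. \<pi> ` e \<in> G}"

lemma relabel_graph_iso:
  assumes "\<pi> \<in> perms n" "G \<subseteq> vpairs n"
  shows "graph_iso n G (relabel n \<pi> G)"
proof -
  have \<pi>: "\<pi> permutes {..<n}" using assms(1) by (simp add: perms_def)
  have inv: "inv \<pi> ` \<pi> ` e = e" "\<pi> ` inv \<pi> ` e = e" for e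
    using permutes_inv_o[OF \<pi>] by (simp_all add: image_comp)
  have in_vpairs: "inv \<pi> ` e \<in> vpairs n" if "e \<in> G" for e
  proof -
    have "inv \<pi> ` e \<subseteq> inv \<pi> ` {..<n}" using that assms(2) by (intro image_mono) (auto simp: vpairs_def)
    moreover have "inv \<pi> ` {..<n} = {..<n}" by (rule permutes_image[OF permutes_inv[OF \<pi>]])
    moreover have "card (inv \<pi> ` e) = card e"
      by (rule card_image) (rule inj_on_subset[OF permutes_inj[OF permutes_inv[OF \<pi>]]], simp)
    ultimately show ?thesis using that assms(2) by (auto simp: vpairs_def)
  qed
  have "relabel n \<pi> G = (\<lambda>e. inv \<pi> ` e) ` G"
  proof (intro equalityI subsetI)
    fix e assume "e \<in> relabel n \<pi> G"
    then have "\<pi> ` e \<in> G" by (simp add: relabel_def)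
    then have "inv \<pi> ` \<pi> ` e \<in> (\<lambda>e. inv \<pi> ` e) ` G" by (rule imageI)
    then show "e \<in> (\<lambda>e. inv \<pi> ` e) ` G" by (simp only: inv)
  next
    fix e assume "e \<in> (\<lambda>e. inv \<pi> ` e) ` G"
    then obtain f where "f \<in> G" "e = inv \<pi> ` f" by blast
    then show "e \<in> relabel n \<pi> G" by (simp add: relabel_def inv(2) in_vpairs)
  qed
  moreover have "bij_betw (inv \<pi>) {..<n} {..<n}"
    by (rule permutes_imp_bij[OF permutes_inv[OF \<pi>]])
  ultimately show ?thesis by (auto simp: graph_iso_def)
qed

lemma card_graph_iso:
  assumes "graph_iso n G G1" "G \<subseteq> vpairs n"
  shows "card G1 = card G"
proof -
  obtain \<pi> where \<pi>: "bij_betw \<pi> {..<n} {..<n}" "G1 = (\<lambda>e. \<pi> ` e) ` G"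
    using assms(1) by (auto simp: graph_iso_def)
  have "inj_on ((`) \<pi>) G"
    by (rule inj_on_subset[OF inj_on_image_Pow[of \<pi> "{..<n}"]])
      (use \<pi>(1) assms(2) in \<open>auto simp: bij_betw_def vpairs_def\<close>)
  then show ?thesis using \<pi>(2) by (simp add: card_image)
qed

text \<open>By symmetry every pair is sent into \<open>G\<close> by the same number of permutations.
  Taking all pairs for \<open>S\<close> determines this number.\<close>

lemma sum_card_relabel_Int:
  assumes "G \<subseteq> vpairs n" "S \<subseteq> vpairs n"
  shows "(n choose 2) * (\<Sum>\<pi>\<in>perms n. card (relabel n \<pi> G \<inter> S)) = card S * (fact n * card G)"
proof -
  define z where "z = (\<lambda>e. card {\<pi> \<in> perms n. \<pi> ` e \<in> G})"
  have z_eq: "z e = z {0, 1}" if "e \<in> vpairs n" for e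
  proof -
    have "card e = 2" using that by (simp add: vpairs_def)
    then obtain a b where ab: "e = {a, b}" "a \<noteq> b" unfolding card_2_iff by blast
    then have e: "e = {a, b}" "a \<noteq> b" "a < n" "b < n"
      using that by (auto simp: vpairs_def)
    obtain \<sigma> where \<sigma>: "\<sigma> \<in> perms n" "map \<sigma> [0..<length [a, b]] = [a, b]"
      using perms_extending_list[of "[a, b]" n] e by auto
    have "\<pi> ` e = (\<pi> \<circ> \<sigma>) ` {0, 1}" for \<pi> :: "nat \<Rightarrow> nat"
      using \<sigma>(2) e by (simp add: upt_rec)
    then show ?thesis
      unfolding z_def using card_perms_compose[OF \<sigma>(1), of "\<lambda>\<pi>. \<pi> ` {0, 1} \<in> G"] by simp
  qed
  have sum_z: "(\<Sum>\<pi>\<in>perms n. card (relabel n \<pi> G \<inter> S)) = card S * z {0, 1}"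
    if S: "S \<subseteq> vpairs n" for S
  proof -
    have "(\<Sum>\<pi>\<in>perms n. card (relabel n \<pi> G \<inter> S)) = (\<Sum>\<pi>\<in>perms n. \<Sum>e\<in>S. of_bool (\<pi> ` e \<in> G))"
    proof (rule sum.cong)
      fix \<pi>
      have "relabel n \<pi> G \<inter> S = S \<inter> {e. \<pi> ` e \<in> G}" using S by (auto simp: relabel_def)
      then show "card (relabel n \<pi> G \<inter> S) = (\<Sum>e\<in>S. of_bool (\<pi> ` e \<in> G))"
        using finite_subset_vpairs[OF S] by simp
    qed simp
    also have "\<dots> = (\<Sum>e\<in>S. \<Sum>\<pi>\<in>perms n. of_bool (\<pi> ` e \<in> G))" by (rule sum.swap)
    also have "\<dots> = (\<Sum>e\<in>S. z e)" by (simp add: z_def finite_perms Int_def)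
    also have "\<dots> = card S * z {0, 1}" using z_eq S by (simp add: subset_iff)
    finally show ?thesis .
  qed
  have "(\<Sum>\<pi>\<in>perms n. card (relabel n \<pi> G \<inter> vpairs n)) = (\<Sum>\<pi>\<in>perms n. card G)"
  proof (rule sum.cong)
    fix \<pi> assume "\<pi> \<in> perms n"
    moreover have "relabel n \<pi> G \<inter> vpairs n = relabel n \<pi> G" by (auto simp: relabel_def)
    ultimately show "card (relabel n \<pi> G \<inter> vpairs n) = card G"
      using card_graph_iso[OF relabel_graph_iso] assms(1) by simp
  qed simp
  then have "(n choose 2) * z {0, 1} = fact n * card G"
    using sum_z[of "vpairs n"] by (simp add: card_vpairs card_perms)
  then show ?thesis using sum_z[OF assms(2)] by (simp add: mult.left_commute)
qed

text \<open>For \<open>3 \<le> k \<le> n\<close>, division by \<open>fact n\<close> gives the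
  probability that a uniformly random permutation carries the standard cycle through 0, 1, ..., k -
  1 into \<open>G\<close>.\<close>

definition cycle_count :: "nat \<Rightarrow> nat \<Rightarrow> edges \<Rightarrow> nat" where
  "cycle_count n k G = card {\<pi> \<in> perms n. walk_edges (\<pi> 0) (map \<pi> [1..<k]) (\<pi> 0) \<subseteq> G}"

text \<open>Composing with a permutation that takes the standard cycle to the given one reduces the
  count to the standard cycle.\<close>

lemma card_relabel_cycle_le:
  assumes "distinct (u # xs)" "set (u # xs) \<subseteq> {..<n}"
  shows "card {\<pi> \<in> perms n. walk_edges u xs u \<subseteq> relabel n \<pi> G} \<le> cycle_count n (Suc (length xs)) G"
proof -
  obtain \<sigma> where \<sigma>: "\<sigma> \<in> perms n" "map \<sigma> [0..<length (u # xs)] = u # xs"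
    using perms_extending_list[OF assms] by (rule bexE)
  have "[0..<length (u # xs)] = 0 # [1..<Suc (length xs)]"
    by (simp add: upt_conv_Cons del: upt_Suc)
  then have "map \<sigma> (0 # [1..<Suc (length xs)]) = u # xs"
    using \<sigma>(2) by (simp only:)
  then have u: "\<sigma> 0 = u" and xs: "map \<sigma> [1..<Suc (length xs)] = xs"
    by (simp_all only: list.map list.inject)
  have "walk_edges (\<pi> (\<sigma> 0)) (map (\<pi> \<circ> \<sigma>) [1..<Suc (length xs)]) (\<pi> (\<sigma> 0)) \<subseteq> G"
    if "walk_edges u xs u \<subseteq> relabel n \<pi> G" for \<pi>
  proof -
    have "map (\<pi> \<circ> \<sigma>) [1..<Suc (length xs)] = map \<pi> xs"
      by (simp only: map_map[symmetric] xs)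
    then have "walk_edges (\<pi> (\<sigma> 0)) (map (\<pi> \<circ> \<sigma>) [1..<Suc (length xs)]) (\<pi> (\<sigma> 0))
        = (`) \<pi> ` walk_edges u xs u"
      by (simp only: u walk_edges_map)
    then show ?thesis using that by (auto simp: relabel_def)
  qed
  then have "card {\<pi> \<in> perms n. walk_edges u xs u \<subseteq> relabel n \<pi> G}
     \<le> card {\<pi> \<in> perms n. walk_edges ((\<pi> \<circ> \<sigma>) 0) (map (\<pi> \<circ> \<sigma>) [1..<Suc (length xs)]) ((\<pi> \<circ> \<sigma>) 0) \<subseteq> G}"
    by (intro card_mono) (auto simp: finite_perms simp del: upt_Suc)
  also have "\<dots> = cycle_count n (Suc (length xs)) G"
    unfolding cycle_count_def by (rule card_perms_compose[OF \<sigma>(1)])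
  finally show ?thesis .
qed

text \<open>Union bound over the cycles in \<open>S\<close>. Those of length \<open>k\<close> are
  among the closed walks with \<open>k - 1\<close> inner vertices, and each one survives at most
  \<open>cycle_count n k G\<close> of the relabellings. Distinctness of the vertices forces
  \<open>k \<le> n\<close>.\<close>

lemma card_relabel_has_cycle_le:
  assumes S: "S \<subseteq> vpairs n"
  shows "real (card {\<pi> \<in> perms n. has_cycle (relabel n \<pi> G \<inter> S)})
    \<le> (\<Sum>k=3..n. sqrt (2 * card S) ^ k * cycle_count n k G)"
proof -
  let ?X = "\<lambda>k u. {xs \<in> walks S (k - 1) u u. distinct (u # xs)}"
  let ?Q = "\<lambda>u xs. {\<pi> \<in> perms n. walk_edges u xs u \<subseteq> relabel n \<pi> G}"
  have US: "\<Union> S \<subseteq> {..<n}" by (rule vpairs_Union_subset[OF S])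
  have fin: "finite (?X k u)" for k u
    using finite_walks[OF _ US] by (rule finite_subset[rotated]) auto
  have in_V: "set (u # xs) \<subseteq> {..<n}" if "walk_edges u xs u \<subseteq> S" for u xs
    using Union_walk_edges[of u xs u] that US by auto
  have "{\<pi> \<in> perms n. has_cycle (relabel n \<pi> G \<inter> S)}
      \<subseteq> (\<Union>k\<in>{3..n}. \<Union>u\<in>{..<n}. \<Union>xs\<in>?X k u. ?Q u xs)"
  proof
    fix \<pi> assume "\<pi> \<in> {\<pi> \<in> perms n. has_cycle (relabel n \<pi> G \<inter> S)}"
    then obtain u xs where \<pi>: "\<pi> \<in> perms n" and xs: "distinct (u # xs)" "2 \<le> length xs"
      "walk_edges u xs u \<subseteq> relabel n \<pi> G" "walk_edges u xs u \<subseteq> S"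
      by (auto simp: has_cycle_def)
    have V: "set (u # xs) \<subseteq> {..<n}" by (rule in_V[OF xs(4)])
    have "length (u # xs) \<le> n"
      using card_mono[OF _ V] distinct_card[OF xs(1)] by simp
    then have "Suc (length xs) \<in> {3..n}" using xs(2) by simp
    moreover have "u \<in> {..<n}" using V by simp
    moreover have "xs \<in> ?X (Suc (length xs)) u" using xs by (simp add: walks_def)
    moreover have "\<pi> \<in> ?Q u xs" using \<pi> xs by simp
    ultimately show "\<pi> \<in> (\<Union>k\<in>{3..n}. \<Union>u\<in>{..<n}. \<Union>xs\<in>?X k u. ?Q u xs)" by blast
  qed
  then have "card {\<pi> \<in> perms n. has_cycle (relabel n \<pi> G \<inter> S)}
      \<le> card (\<Union>k\<in>{3..n}. \<Union>u\<in>{..<n}. \<Union>xs\<in>?X k u. ?Q u xs)"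
    by (rule card_mono[rotated]) (intro finite_UN_I finite_atLeastAtMost finite_lessThan fin, simp add: finite_perms)
  also have "\<dots> \<le> (\<Sum>k\<in>{3..n}. card (\<Union>u\<in>{..<n}. \<Union>xs\<in>?X k u. ?Q u xs))"
    by (rule card_UN_le) simp
  also have "\<dots> \<le> (\<Sum>k\<in>{3..n}. \<Sum>u\<in>{..<n}. card (\<Union>xs\<in>?X k u. ?Q u xs))"
    by (intro sum_mono card_UN_le) simp
  also have "\<dots> \<le> (\<Sum>k\<in>{3..n}. \<Sum>u\<in>{..<n}. \<Sum>xs\<in>?X k u. card (?Q u xs))"
    by (intro sum_mono card_UN_le fin)
  also have "\<dots> \<le> (\<Sum>k\<in>{3..n}. \<Sum>u\<in>{..<n}. \<Sum>xs\<in>?X k u. cycle_count n k G)"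
  proof (intro sum_mono)
    fix k u xs assume k: "k \<in> {3..n}" and xs: "xs \<in> ?X k u"
    then have "k = Suc (length xs)" by (auto simp: walks_def)
    then show "card (?Q u xs) \<le> cycle_count n k G"
      using card_relabel_cycle_le[of u xs n G] in_V[of u xs] xs by (simp add: walks_def)
  qed
  also have "\<dots> \<le> (\<Sum>k\<in>{3..n}. \<Sum>u\<in>{..<n}. card (walks S (k - 1) u u) * cycle_count n k G)"
    using finite_walks[OF _ US] by (auto intro!: sum_mono mult_right_mono card_mono)
  finally have "real (card {\<pi> \<in> perms n. has_cycle (relabel n \<pi> G \<inter> S)})
      \<le> real (\<Sum>k\<in>{3..n}. \<Sum>u\<in>{..<n}. card (walks S (k - 1) u u) * cycle_count n k G)"
    by (rule of_nat_mono)
  also have "\<dots> = (\<Sum>k\<in>{3..n}. (\<Sum>u\<in>{..<n}. real (card (walks S (k - 1) u u))) * cycle_count n k G)"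
    by (simp add: sum_distrib_right)
  also have "\<dots> \<le> (\<Sum>k\<in>{3..n}. sqrt (2 * card S) ^ k * cycle_count n k G)"
  proof (intro sum_mono mult_right_mono)
    fix k assume "k \<in> {3..n}"
    \<comment> \<open>The closed walk bound is used with \<open>m = k - 2\<close>: then
      \<open>Suc m\<close> inner vertices are \<open>k - 1\<close>, and its exponent
      \<open>m + 2\<close> is \<open>k\<close>.\<close>
    then have "k - 1 = Suc (k - 2)" "k = k - 2 + 2" by auto
    then show "(\<Sum>u\<in>{..<n}. real (card (walks S (k - 1) u u))) \<le> sqrt (2 * card S) ^ k"
      using sum_closed_walks_le[of "{..<n}" S "k - 2"] US finite_subset_vpairs[OF S] S
      by (auto simp: vpairs_def subset_iff)
  qed simp
  finally show ?thesis .
qed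

text \<open>The preceding union bound, read as a probability over relabellings, with
  \<open>b\<close> in place of \<open>sqrt (2 * card S)\<close>; the query set no longer occurs in
  it.\<close>

definition cycle_weight :: "nat \<Rightarrow> real \<Rightarrow> edges \<Rightarrow> real" where
  "cycle_weight n b G = (\<Sum>k=3..n. b ^ k * cycle_count n k G) / fact n"

lemma cycle_weight_nonneg: "0 \<le> b \<Longrightarrow> 0 \<le> cycle_weight n b G"
  by (auto simp: cycle_weight_def intro!: divide_nonneg_nonneg sum_nonneg)

text \<open>Each permutation takes the standard cycle to \<open>k\<close> distinct pairs, which are
  all present with probability \<open>p ^ k\<close>.\<close>

lemma expectation_cycle_count:
  assumes p: "0 \<le> p" "p \<le> 1" and k: "3 \<le> k" "k \<le> n"
  shows "measure_pmf.expectation (gnp n p) (\<lambda>G. real (cycle_count n k G)) = fact n * p ^ k"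
proof -
  let ?w = "\<lambda>\<pi>. walk_edges (\<pi> 0) (map \<pi> [1..<k]) (\<pi> 0)"
  have w: "measure_pmf.expectation (gnp n p) (\<lambda>G. of_bool (?w \<pi> \<subseteq> G)) = p ^ k"
    if "\<pi> \<in> perms n" for \<pi>
  proof -
    have \<pi>: "\<pi> permutes {..<n}" using that by (simp add: perms_def)
    have d: "distinct (0 # [1..<k])" "2 \<le> length [1..<k]" using k by auto
    have inj: "inj_on ((`) \<pi>) (walk_edges 0 [1..<k] 0)"
      using inj_on_image_Pow[OF permutes_inj[OF \<pi>]] by (rule inj_on_subset) simp
    have "card (?w \<pi>) = k"
      unfolding walk_edges_map card_image[OF inj] card_walk_edges_cycle[OF d] using k by simp
    moreover have "?w \<pi> \<subseteq> vpairs n"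
    proof
      fix e assume e: "e \<in> ?w \<pi>"
      then obtain f where f: "f \<in> walk_edges 0 [1..<k] 0" "e = \<pi> ` f"
        by (auto simp: walk_edges_map)
      have "f \<subseteq> insert 0 (set [1..<k])"
        using f(1) Union_walk_edges[of 0 "[1..<k]" 0] by blast
      then have "f \<subseteq> {..<n}" using k by auto
      then have "e \<subseteq> {..<n}" using f(2) permutes_image[OF \<pi>] by blast
      moreover have "card f = 2"
        using card_edge_of_cycle[OF d(1) _ f(1)] k by simp
      then have "card e = 2"
        using f(2) by (simp add: card_image inj_on_subset[OF permutes_inj[OF \<pi>]])
      ultimately show "e \<in> vpairs n" by (simp add: vpairs_def)
    qed
    ultimately show ?thesis using expectation_gnp_superset[OF p] by simp
  qed
  have "measure_pmf.expectation (gnp n p) (\<lambda>G. real (cycle_count n k G))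
      = measure_pmf.expectation (gnp n p) (\<lambda>G. \<Sum>\<pi>\<in>perms n. of_bool (?w \<pi> \<subseteq> G))"
    by (simp add: cycle_count_def finite_perms Int_def)
  also have "\<dots> = (\<Sum>\<pi>\<in>perms n. p ^ k)"
    using w by (simp add: integrable_gnp del: sum_of_bool_eq)
  finally show ?thesis by (simp add: card_perms)
qed

lemma sum_powers_le:
  fixes a :: real
  assumes "0 \<le> a" "a \<le> 1 / 2"
  shows "(\<Sum>k=3..n. a ^ k) \<le> a\<^sup>2"
proof -
  \<comment> \<open>The subtracted \<open>a ^ n\<close> absorbs the new term in the induction,
    because \<open>2 * a ^ Suc n\<close> is at most \<open>a ^ n\<close>.\<close>
  have "(\<Sum>k=3..n. a ^ k) \<le> a\<^sup>2 - a ^ n" if "2 \<le> n"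
    using that
  proof (induction n rule: dec_induct)
    case (step n)
    have "a * a ^ n \<le> 1 / 2 * a ^ n" using assms by (intro mult_right_mono) auto
    then show ?case using step by simp
  qed simp
  moreover have "0 \<le> a ^ n" using assms by simp
  ultimately show ?thesis by (cases "2 \<le> n") fastforce+
qed

text \<open>With \<open>b = a / p\<close> the factor \<open>p ^ k\<close> of the expected cycle
  count cancels and the sum of \<open>a ^ k\<close> remains; Markov's inequality does the
  rest.\<close>

lemma cycle_weight_upper_tail:
  assumes p: "0 < p" "p \<le> 1" and a: "0 < a" "a \<le> 1 / 2" and t: "0 < t"
  shows "measure_pmf.prob (gnp n p) {G. t \<le> cycle_weight n (a / p) G} \<le> a\<^sup>2 / t"
proof -
  have "measure_pmf.expectation (gnp n p) (cycle_weight n (a / p))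
      = (\<Sum>k=3..n. (a / p) ^ k * measure_pmf.expectation (gnp n p) (\<lambda>G. real (cycle_count n k G))) / fact n"
    unfolding cycle_weight_def by (simp add: integrable_gnp)
  also have "\<dots> = (\<Sum>k=3..n. (a / p) ^ k * (fact n * p ^ k)) / fact n"
    using p by (intro arg_cong2[of _ _ _ _ "(/)"] sum.cong) (auto simp: expectation_cycle_count)
  also have "\<dots> = (\<Sum>k=3..n. a ^ k)"
    using p by (simp add: power_divide sum_divide_distrib)
  also have "\<dots> \<le> a\<^sup>2" using a by (intro sum_powers_le) auto
  finally have E: "measure_pmf.expectation (gnp n p) (cycle_weight n (a / p)) \<le> a\<^sup>2" .
  have "measure_pmf.prob (gnp n p) {G \<in> space (measure_pmf (gnp n p)). t \<le> cycle_weight n (a / p) G}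
      \<le> measure_pmf.expectation (gnp n p) (cycle_weight n (a / p)) / t"
    by (rule integral_Markov_inequality_measure[of _ _ "{}"])
      (use p a t in \<open>auto intro!: integrable_gnp cycle_weight_nonneg AE_I2\<close>)
  also have "\<dots> \<le> a\<^sup>2 / t" using E t by (intro divide_right_mono) auto
  finally show ?thesis by simp
qed

section \<open>The lower bound\<close>

text \<open>Every relabelling of the whole of \<open>G\<close> is a valid input and costs at most
  \<open>s\<close>. Averaged over relabellings, a queried pair is an edge with frequency
  \<open>card G\<close> over \<open>n choose 2\<close>, which is at least
  \<open>p / 2\<close>.\<close>

lemma expected_query_size_le:
  assumes sol: "solves n G \<epsilon> \<delta> s D A" and G: "G \<subseteq> vpairs n"
    and m: "real (n choose 2) * p / 2 \<le> real (card G)" and p: "0 < p" and n: "2 \<le> n"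
  shows "(\<Sum>S\<in>Pow (vpairs n). pmf D S * card S) \<le> 2 * s / p"
proof -
  let ?PS = "Pow (vpairs n)"
  let ?M = "real (n choose 2)"
  define L where "L = (\<Sum>S\<in>?PS. pmf D S * card S)"
  have D: "set_pmf D \<subseteq> ?PS" using sol by (simp add: solves_def)
  have M: "0 < ?M" using n by simp
  have L: "0 \<le> L" unfolding L_def by (intro sum_nonneg) auto
  have cost: "(\<Sum>S\<in>?PS. pmf D S * card (relabel n \<pi> G \<inter> S)) \<le> s" if "\<pi> \<in> perms n" for \<pi>
  proof -
    have "sample_cost D (relabel n \<pi> G) \<le> s"
      using sol relabel_graph_iso[OF that G] unfolding solves_def by blast
    then show ?thesis by (simp only: sample_cost_eq[OF D])
  qed
  have avg: "?M * (\<Sum>\<pi>\<in>perms n. real (card (relabel n \<pi> G \<inter> S))) = card S * (fact n * card G)"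
    if "S \<in> ?PS" for S
    using arg_cong[OF sum_card_relabel_Int[OF G, of S], of real] that by simp
  have "fact n * (L * card G) = (\<Sum>S\<in>?PS. pmf D S * (card S * (fact n * card G)))"
    by (simp add: L_def sum_distrib_left sum_distrib_right mult_ac)
  also have "\<dots> = (\<Sum>S\<in>?PS. pmf D S * (?M * (\<Sum>\<pi>\<in>perms n. real (card (relabel n \<pi> G \<inter> S)))))"
    using avg by (intro sum.cong) auto
  also have "\<dots> = ?M * (\<Sum>S\<in>?PS. \<Sum>\<pi>\<in>perms n. pmf D S * card (relabel n \<pi> G \<inter> S))"
    by (simp add: sum_distrib_left mult_ac)
  also have "\<dots> = ?M * (\<Sum>\<pi>\<in>perms n. \<Sum>S\<in>?PS. pmf D S * card (relabel n \<pi> G \<inter> S))"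
    by (subst sum.swap) simp
  also have "\<dots> \<le> ?M * (\<Sum>\<pi>\<in>perms n. s)"
    using M by (intro mult_left_mono sum_mono cost) auto
  also have "\<dots> = fact n * (?M * s)" by (simp add: card_perms)
  finally have "L * card G \<le> ?M * s" by simp
  moreover have "L * (?M * p / 2) \<le> L * card G" by (rule mult_left_mono[OF m L])
  ultimately have "?M * (L * p / 2) \<le> ?M * s" by (simp add: mult_ac)
  then have "L * p / 2 \<le> s" using M by (simp only: mult_le_cancel_left_pos)
  then have "L \<le> 2 * s / p" using p by (simp add: field_simps)
  then show ?thesis by (simp only: L_def)
qed

text \<open>The bound on the probability of seeing a cycle is averaged over all relabellings, and
  the queries are split by size at \<open>2 * card S = (a / p)^2\<close>. Small ones are covered by
  the cycle weight, large ones by the bound on the mean query size.\<close>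

lemma solves_lower_bound:
  assumes sol: "solves n G \<epsilon> (1 / 10) s D A" and G: "G \<subseteq> vpairs n" "num_triangles G > 0"
    and m: "real (n choose 2) * p / 2 \<le> real (card G)" and p: "0 < p" and n: "2 \<le> n"
    and a: "0 < a" and \<epsilon>: "0 \<le> \<epsilon>"
  shows "1 / 8 - 2 * \<epsilon> \<le> cycle_weight n (a / p) G + 4 * s * p / a\<^sup>2"
proof -
  let ?PS = "Pow (vpairs n)"
  let ?Y = "cycle_weight n (a / p) G"
  let ?cyc = "\<lambda>S. {\<pi> \<in> perms n. has_cycle (relabel n \<pi> G \<inter> S)}"
  have D: "set_pmf D \<subseteq> ?PS" using sol by (simp add: solves_def)
  have Y0: "0 \<le> ?Y" using a p by (intro cycle_weight_nonneg) auto
  have cyc: "real (card (?cyc S)) \<le> fact n * (?Y + card S * (2 * p\<^sup>2 / a\<^sup>2))" if S: "S \<in> ?PS" for S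
  proof (cases "sqrt (2 * card S) \<le> a / p")
    case True
    have "real (card (?cyc S)) \<le> (\<Sum>k=3..n. sqrt (2 * card S) ^ k * cycle_count n k G)"
      using card_relabel_has_cycle_le S by simp
    also have "\<dots> \<le> (\<Sum>k=3..n. (a / p) ^ k * cycle_count n k G)"
      by (intro sum_mono mult_right_mono power_mono True) auto
    also have "\<dots> = fact n * ?Y" by (simp add: cycle_weight_def)
    also have "\<dots> \<le> fact n * (?Y + card S * (2 * p\<^sup>2 / a\<^sup>2))"
      by (intro mult_left_mono) auto
    finally show ?thesis .
  next
    case False
    \<comment> \<open>For a large query the second summand alone is at least 1, and the trivial
      bound by all permutations suffices, as in Markov's inequality.\<close>
    then have "(a / p)\<^sup>2 \<le> (sqrt (2 * card S))\<^sup>2"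
      using a p by (intro power_mono) auto
    then have "1 \<le> card S * (2 * p\<^sup>2 / a\<^sup>2)"
      using a p by (simp add: field_simps)
    then have "1 \<le> ?Y + card S * (2 * p\<^sup>2 / a\<^sup>2)" using Y0 by linarith
    then have "fact n * 1 \<le> fact n * (?Y + card S * (2 * p\<^sup>2 / a\<^sup>2))"
      by (intro mult_left_mono) auto
    moreover have "card (?cyc S) \<le> card (perms n)"
      by (intro card_mono finite_perms) auto
    then have "real (card (?cyc S)) \<le> real (fact n)"
      unfolding card_perms by (rule of_nat_mono)
    then have "real (card (?cyc S)) \<le> fact n" by (simp only: of_nat_fact)
    ultimately show ?thesis by linarith
  qed
  have "fact n * (1 / 8 - 2 * \<epsilon>) = (\<Sum>\<pi>\<in>perms n. 1 / 8 - 2 * \<epsilon>)" by (simp add: card_perms)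
  also have "\<dots> \<le> (\<Sum>\<pi>\<in>perms n. \<Sum>S\<in>?PS. pmf D S * of_bool (has_cycle (relabel n \<pi> G \<inter> S)))"
    by (intro sum_mono solves_imp_cycle_prob_ge[OF sol G _ \<epsilon>] relabel_graph_iso G)
  also have "\<dots> = (\<Sum>S\<in>?PS. pmf D S * card (?cyc S))"
    by (subst sum.swap) (simp add: finite_perms Int_def flip: sum_distrib_left)
  also have "\<dots> \<le> (\<Sum>S\<in>?PS. pmf D S * (fact n * (?Y + card S * (2 * p\<^sup>2 / a\<^sup>2))))"
    by (intro sum_mono mult_left_mono cyc) auto
  also have "\<dots> = fact n * (?Y * (\<Sum>S\<in>?PS. pmf D S) + (\<Sum>S\<in>?PS. pmf D S * card S) * (2 * p\<^sup>2 / a\<^sup>2))"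
    by (simp add: algebra_simps sum.distrib sum_distrib_left sum_distrib_right sum_divide_distrib)
  also have "(\<Sum>S\<in>?PS. pmf D S) = 1"
    by (rule sum_pmf_eq_1[OF _ D]) (simp add: finite_vpairs)
  finally have "1 / 8 - 2 * \<epsilon> \<le> ?Y + (\<Sum>S\<in>?PS. pmf D S * card S) * (2 * p\<^sup>2 / a\<^sup>2)"
    by (simp only: mult_le_cancel_left_pos fact_gt_zero mult_1_right)
  also have "(\<Sum>S\<in>?PS. pmf D S * card S) * (2 * p\<^sup>2 / a\<^sup>2) \<le> 2 * s / p * (2 * p\<^sup>2 / a\<^sup>2)"
    by (intro mult_right_mono expected_query_size_le[OF sol G(1) m p n]) auto
  also have "\<dots> = 4 * s * p / a\<^sup>2" using p by (simp add: power2_eq_square)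
  finally show ?thesis by simp
qed

lemma instopt_lower_bound:
  assumes G: "G \<subseteq> vpairs n" "num_triangles G > 0"
    and m: "real (n choose 2) * p / 2 \<le> real (card G)" and p: "0 < p" and n: "2 \<le> n"
    and a: "0 < a" and \<epsilon>: "0 \<le> \<epsilon>" "\<epsilon> \<le> 1 / 100" and Y: "cycle_weight n (a / p) G \<le> 1 / 100"
  shows "a\<^sup>2 / 400 * (1 / p) \<le> instopt n G \<epsilon> (1 / 10)"
  unfolding instopt_def
proof (rule cInf_greatest)
  show "{s. \<exists>D A. solves n G \<epsilon> (1 / 10) s D A} \<noteq> {}"
    by (rule instopt_nonempty) (use G \<epsilon> in auto)
  fix s assume "s \<in> {s. \<exists>D A. solves n G \<epsilon> (1 / 10) s D A}"
  then obtain D A where "solves n G \<epsilon> (1 / 10) s D A" by blast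
  then have "1 / 8 - 2 * \<epsilon> \<le> cycle_weight n (a / p) G + 4 * s * p / a\<^sup>2"
    by (rule solves_lower_bound[OF _ G m p n a \<epsilon>(1)])
  \<comment> \<open>The left side is at least 1/8 - 2/100, and after subtracting the cycle weight
    more than 1/100 remains.\<close>
  then have "1 / 100 \<le> 4 * s * p / a\<^sup>2" using Y \<epsilon> by linarith
  then show "a\<^sup>2 / 400 * (1 / p) \<le> s" using a p by (simp add: field_simps)
qed

text \<open>Union bound over three exceptional events: too few edges, no triangle, too large a cycle
  weight. The constants depend on \<open>\<eta>\<close> at most.\<close>

theorem mainTheorem8:
  fixes \<eta> :: real
  assumes "\<eta> > 0"
  shows "\<exists>C>0. \<exists>\<epsilon>\<^sub>0>0. \<exists>c>0. \<forall>(n::nat) (p::real) (\<epsilon>::real).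
           0 < n \<longrightarrow> C / real n \<le> p \<longrightarrow> p \<le> 1 \<longrightarrow> 0 < \<epsilon> \<longrightarrow> \<epsilon> < \<epsilon>\<^sub>0 \<longrightarrow>
             measure_pmf.prob (gnp n p) {G. instopt n G \<epsilon> (1/10) \<ge> c * (1 / p)} \<ge> 1 - \<eta>"
proof -
  \<comment> \<open>The cap 1/2 serves the geometric sum; \<open>\<eta> / 300\<close> brings the
    Markov bound \<open>100 * a * a\<close> down to \<open>\<eta> / 6\<close>.\<close>
  define a where "a = min (1 / 2) (\<eta> / 300)"
  \<comment> \<open>The summand 3 forces \<open>n \<ge> 3\<close>. The other one makes 448 /
    \<open>C\<close> at most \<open>\<eta> / 2\<close>, where 448 = 16 + 108 + 324 collects the
    constants of the edge and triangle bounds.\<close>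
  define C where "C = 3 + 1296 / \<eta>"
  have a: "0 < a" "a \<le> 1 / 2" "a \<le> \<eta> / 300" using assms by (auto simp: a_def)
  have C: "3 \<le> C" "448 / C \<le> \<eta> / 2"
    using assms by (auto simp: C_def field_simps)
  have main: "1 - \<eta> \<le> measure_pmf.prob (gnp n p) {G. a\<^sup>2 / 400 * (1 / p) \<le> instopt n G \<epsilon> (1 / 10)}"
    if n: "0 < n" and pC: "C / real n \<le> p" and p1: "p \<le> 1" and \<epsilon>: "0 < \<epsilon>" "\<epsilon> < 1 / 100"
    for n :: nat and p \<epsilon> :: real
  proof -
    let ?P = "measure_pmf.prob (gnp n p)"
    let ?A = "{G. a\<^sup>2 / 400 * (1 / p) \<le> instopt n G \<epsilon> (1 / 10)}"
    let ?B1 = "{G. real (card (G \<inter> vpairs n)) < real (n choose 2) * p / 2}"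
    let ?B2 = "{G. num_triangles G = 0}"
    let ?B3 = "{G. 1 / 100 \<le> cycle_weight n (a / p) G}"
    have np: "C \<le> real n * p" using pC n by (simp add: field_simps)
    have "0 < C / real n" using C n by simp
    then have p0: "0 < p" using pC by linarith
    have "real n * p \<le> real n" using p1 by (simp add: mult_left_le)
    then have "3 \<le> real n" using np C by linarith
    then have n3: "3 \<le> n" by simp
    \<comment> \<open>The denominators of the edge and triangle bounds are at least
      \<open>real n * p\<close>, hence at least \<open>C\<close>.\<close>
    have n2p: "C \<le> real n ^ 2 * p"
    proof -
      have "1 * (real n * p) \<le> real n * (real n * p)"
        using \<open>3 \<le> real n\<close> p0 by (intro mult_right_mono) auto
      then show ?thesis using np by (simp add: power2_eq_square mult.assoc)
    qed
    have np3: "C \<le> (real n * p) ^ 3"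
    proof -
      have "(real n * p) ^ 1 \<le> (real n * p) ^ 3"
        using np C by (intro power_increasing) auto
      then show ?thesis using np by simp
    qed
    have pos: "0 < C" "0 < real n ^ 2 * p" "0 < (real n * p) ^ 3"
      using n2p np3 C by linarith+
    have "?P ?B1 \<le> 16 / (real n ^ 2 * p)"
      by (rule gnp_few_edges) (use p0 p1 n3 in auto)
    also have "\<dots> \<le> 16 / C" using n2p C by (intro divide_left_mono) auto
    finally have B1: "?P ?B1 \<le> 16 / C" .
    have "?P ?B2 \<le> 108 / (real n * p) ^ 3 + 324 / (real n ^ 2 * p)"
      by (rule gnp_no_triangle) (use p0 p1 n3 in auto)
    also have "\<dots> \<le> 108 / C + 324 / C"
      by (intro add_mono divide_left_mono mult_pos_pos[OF _ pos(1)] pos n2p np3) simp_all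
    finally have B2: "?P ?B2 \<le> 108 / C + 324 / C" .
    have "?P ?B3 \<le> a\<^sup>2 / (1 / 100)"
      by (rule cycle_weight_upper_tail) (use p0 p1 a in auto)
    also have "\<dots> = 100 * a * a" by (simp add: power2_eq_square)
    also have "\<dots> \<le> 100 * a * (1 / 2)" using a by (intro mult_left_mono) auto
    also have "\<dots> \<le> \<eta> / 6" using a(3) by simp
    finally have B3: "?P ?B3 \<le> \<eta> / 6" .
    have "?P (- ?A) \<le> ?P (?B1 \<union> ?B2 \<union> ?B3)"
    proof (rule measure_pmf.finite_measure_mono_AE)
      show "AE G in measure_pmf (gnp n p). G \<in> - ?A \<longrightarrow> G \<in> ?B1 \<union> ?B2 \<union> ?B3"
      proof (rule AE_pmfI, rule impI, rule ccontr)
        fix G assume G: "G \<in> set_pmf (gnp n p)" "G \<in> - ?A" "G \<notin> ?B1 \<union> ?B2 \<union> ?B3"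
        have sub: "G \<subseteq> vpairs n" using G(1) set_pmf_gnp by blast
        then have "G \<inter> vpairs n = G" by blast
        then have "a\<^sup>2 / 400 * (1 / p) \<le> instopt n G \<epsilon> (1 / 10)"
          using G(3) sub p0 n3 a \<epsilon> by (intro instopt_lower_bound) auto
        then show False using G(2) by simp
      qed
    qed simp
    also have "\<dots> \<le> ?P (?B1 \<union> ?B2) + ?P ?B3"
      by (rule measure_Un_le) auto
    also have "?P (?B1 \<union> ?B2) \<le> ?P ?B1 + ?P ?B2"
      by (rule measure_Un_le) auto
    finally have "?P (- ?A) \<le> 16 / C + (108 / C + 324 / C) + \<eta> / 6"
      using B1 B2 B3 by linarith
    also have "\<dots> = 448 / C + \<eta> / 6" by (simp add: add_divide_distrib[symmetric])
    also have "\<dots> \<le> \<eta>" using C(2) assms by simp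
    finally have "?P (- ?A) \<le> \<eta>" .
    moreover have "?P (- ?A) = 1 - ?P ?A"
      using measure_pmf.prob_compl[of ?A "gnp n p"] by (simp add: Compl_eq_Diff_UNIV)
    ultimately show ?thesis by linarith
  qed
  have "0 < C" "0 < a\<^sup>2 / 400" "(0 :: real) < 1 / 100" using C a by simp_all
  with main show ?thesis by blast
qed

end
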